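(* For every real number $b>0$ there exists a constant $c=c(b)\in\mathbb{R}$, depending only on $b$, such that for every function $V:\mathbb{S}_4\to\mathbb{R}$ satisfying $0\le V(x)\le b$ for all $x\in\mathbb{S}_4$, and every solution $u:\mathbb{S}_4\to\mathbb{R}$ of the Paneitz equation $$\Delta^2 u+2\Delta u+6=V e^{4u}\quad\text{on }\mathbb{S}_4,$$ one has $$\sup_{\mathbb{S}_4}u+\inf_{\mathbb{S}_4}u\ \ge\ c .$$
   Context: $\mathbb{S}_4$ denotes the $4$-dimensional unit sphere with its standard round Riemannian metric. The Laplace–Beltrami operator is taken with the geometers' sign convention $\Delta=-\nabla^i\nabla_i$ (so $\Delta$ is a nonnegative operator), and $\Delta^2 u=\Delta(\Delta u)$. A solution is understood in the classical sense: $u\in C^4(\mathbb{S}_4)$ and the equation holds at every point of $\mathbb{S}_4$. The constant $c$ is independent of both $V$ and $u$. *)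

theory Defs
  imports "HOL-Analysis.Analysis"
begin

text \<open>
  Scalar functions and vector fields on the sphere are represented by functions on the ambient
  space \<open>real^5\<close>, of which only the values on the unit sphere matter: all derivatives below
  are taken within the sphere.
\<close>

abbreviation S4 :: "(real^5) set" where
  "S4 \<equiv> sphere 0 1"

fun C_k_on :: "nat \<Rightarrow> 'a::euclidean_space set \<Rightarrow> ('a \<Rightarrow> real) \<Rightarrow> bool" where
  "C_k_on 0 U f \<longleftrightarrow> continuous_on U f"
| "C_k_on (Suc k) U f \<longleftrightarrow>
     (\<exists>g. (\<forall>x\<in>U. (f has_derivative (\<lambda>h. g x \<bullet> h)) (at x)) \<and>
          (\<forall>e\<in>Basis. C_k_on k U (\<lambda>x. g x \<bullet> e)))"

text \<open>Functions of class \<open>C\<^sup>k\<close> on an embedded submanifold: locally restrictions of functions of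
  class \<open>C\<^sup>k\<close> on open subsets of the ambient space.\<close>

definition C_k_on_S4 :: "nat \<Rightarrow> (real^5 \<Rightarrow> real) \<Rightarrow> bool" where
  "C_k_on_S4 k u \<longleftrightarrow>
     (\<forall>x\<in>S4. \<exists>U f. open U \<and> x \<in> U \<and> C_k_on k U f \<and> (\<forall>y\<in>U \<inter> S4. f y = u y))"

text \<open>Orthogonal projection onto the tangent space \<open>{v. v \<bullet> x = 0}\<close> of the sphere at \<open>x\<close>.\<close>

definition tan_proj :: "real^5 \<Rightarrow> real^5 \<Rightarrow> real^5" where
  "tan_proj x v = v - (v \<bullet> x) *\<^sub>R x"

text \<open>The Riemannian gradient for the induced (round) metric. A derivative within the sphere is
  determined only on tangent vectors, so requiring the gradient to be tangent makes it unique.\<close>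

definition grad_S4 :: "(real^5 \<Rightarrow> real) \<Rightarrow> real^5 \<Rightarrow> real^5" where
  "grad_S4 u x =
     (THE g. g \<bullet> x = 0 \<and> (u has_derivative (\<lambda>h. g \<bullet> h)) (at x within S4))"

text \<open>The Levi-Civita connection of the round metric: the tangential part of the ambient directional
  derivative of the tangent field \<open>X\<close>. It is meaningful for tangent \<open>v\<close>, on which
  every Frechet derivative of \<open>X\<close> within the sphere takes the same value.\<close>

definition cov_deriv_S4 :: "(real^5 \<Rightarrow> real^5) \<Rightarrow> real^5 \<Rightarrow> real^5 \<Rightarrow> real^5" where
  "cov_deriv_S4 X x v = tan_proj x (frechet_derivative X (at x within S4) v)"

text \<open>The divergence \<open>\<nabla>\<^sub>i X\<^sup>i\<close>, i.e. the trace of the endomorphism \<open>v \<mapsto> \<nabla>\<^sub>v X\<close> of the tangent space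
  at \<open>x\<close>. Precomposing with the projection extends this endomorphism by zero on the normal
  line, which does not change its trace.\<close>

definition div_S4 :: "(real^5 \<Rightarrow> real^5) \<Rightarrow> real^5 \<Rightarrow> real" where
  "div_S4 X x = trace (matrix (\<lambda>v. cov_deriv_S4 X x (tan_proj x v)))"

text \<open>The Laplace-Beltrami operator with the geometers' sign, \<open>\<Delta> = - \<nabla>\<^sup>i \<nabla>\<^sub>i\<close>.\<close>

definition laplace_S4 :: "(real^5 \<Rightarrow> real) \<Rightarrow> real^5 \<Rightarrow> real" where
  "laplace_S4 u x = - div_S4 (grad_S4 u) x"

definition paneitz_solution :: "(real^5 \<Rightarrow> real) \<Rightarrow> (real^5 \<Rightarrow> real) \<Rightarrow> bool" where
  "paneitz_solution V u \<longleftrightarrow> C_k_on_S4 4 u \<and>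
     (\<forall>x\<in>S4. laplace_S4 (laplace_S4 u) x + 2 * laplace_S4 u x + 6 = V x * exp (4 * u x))"

end

theory Submission
  imports Defs "HOL-Probability.Probability_Measure"
begin

text \<open>
  Write \<open>f = V e\<^sup>4\<^sup>u\<close> for the right-hand side of the equation and let integrals be means over the sphere. The
  Paneitz operator \<open>P = \<Delta>\<^sup>2 + 2 \<Delta>\<close> is symmetric and annihilates constants, so \<open>f\<close> has mean \<open>6\<close>. Its Green
  function is, up to a constant, a multiple of the logarithm of the chordal distance; this gives
  \<open>u p - u q = 1/6 \<integral> (ln (1 - q \<bullet> y) - ln (1 - p \<bullet> y)) f(y)\<close>
  for all points \<open>p\<close> and \<open>q\<close>. Let \<open>p\<close> be a maximum and \<open>q\<close> a minimum of \<open>u\<close>. The first logarithm is bounded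
  above. Of all densities with mean \<open>6\<close> that are at most \<open>b e\<^sup>4\<^sup>M\<close>, where \<open>M = u p\<close>, the second term is
  largest for one that fills a ball about \<open>p\<close> of volume comparable to \<open>e\<^sup>-\<^sup>4\<^sup>M\<close>, that is of radius
  comparable to \<open>e\<^sup>-\<^sup>M\<close>; the average of \<open>- ln (1 - p \<bullet> y)\<close> over it is \<open>2 M\<close> up to a bounded amount. Hence
  \<open>u p - u q \<le> 2 M + C\<close>, which is the claim \<open>u p + u q \<ge> - C\<close>.

  To stay with smooth functions, the pole is regularised: \<open>ln (a - p \<bullet> y)\<close> with \<open>a > 1\<close> satisfies
  \<open>P ln (a - p \<bullet> y) = 6 - 6 * bubble a p y\<close> exactly (\<open>paneitz_ln\<close>), where the bubbles are an approximate
  identity at \<open>p\<close> as \<open>a \<rightarrow> 1\<close> (\<open>integral_bubble\<close>, \<open>bubble_tendsto\<close>). The same bubbles, at scale \<open>r\<close>, bound the volume of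
  small caps and with it the concentrated part of the logarithm (\<open>integral_log_excess\<close>).

  The symmetry of \<open>P\<close> comes from rotation invariance. The Laplacian is \<open>- 1/2\<close> times the sum of the
  squares of the derivatives along the rotations in the coordinate planes (\<open>laplace_S4_eq_rot_deriv\<close>), and such a
  derivative has mean \<open>0\<close> (\<open>integral_rot_deriv\<close>). Green's identity (\<open>Green_S4\<close>) follows from the product rule.
\<close>

section \<open>Functions of class \<open>C\<^sup>k\<close>\<close>

lemma C_k_on_subset: "C_k_on k U f \<Longrightarrow> V \<subseteq> U \<Longrightarrow> C_k_on k V f"
proof (induction k arbitrary: f)
  case 0 then show ?case by (auto intro: continuous_on_subset)
next
  case (Suc k)
  from Suc.prems obtain g where "\<forall>x\<in>U. (f has_derivative (\<lambda>h. g x \<bullet> h)) (at x)"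
    "\<forall>e\<in>Basis. C_k_on k U (\<lambda>x. g x \<bullet> e)" by auto
  with Suc show ?case by (auto intro!: exI[of _ g])
qed

lemma C_k_on_pred: "C_k_on (Suc k) U f \<Longrightarrow> C_k_on k U f"
proof (induction k arbitrary: f)
  case 0
  then have "f differentiable at x" if "x \<in> U" for x
    using that by (auto simp: differentiable_def)
  then show ?case
    by (simp add: differentiable_imp_continuous_on differentiable_at_imp_differentiable_on)
next
  case (Suc k)
  from Suc.prems obtain g where "\<forall>x\<in>U. (f has_derivative (\<lambda>h. g x \<bullet> h)) (at x)"
    "\<forall>e\<in>Basis. C_k_on (Suc k) U (\<lambda>x. g x \<bullet> e)" by (auto simp only: C_k_on.simps)
  with Suc.IH show ?case unfolding C_k_on.simps(2)[of k] by blast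
qed

lemma C_k_on_le: "C_k_on n U f \<Longrightarrow> m \<le> n \<Longrightarrow> C_k_on m U f"
proof (induction n)
  case (Suc n) then show ?case by (metis C_k_on_pred le_Suc_eq)
qed simp

lemma C_k_on_const: "C_k_on k U (\<lambda>x. c)"
proof (induction k arbitrary: c)
  case (Suc k)
  have 1: "\<forall>x\<in>U. ((\<lambda>x. c) has_derivative (\<lambda>h. 0 \<bullet> h)) (at x)" by simp
  have 2: "\<forall>e\<in>Basis. C_k_on k U (\<lambda>x. 0 \<bullet> e)" using Suc.IH[of 0] by simp
  show ?case unfolding C_k_on.simps
    by (rule exI[of _ "\<lambda>x. 0"], rule conjI[OF 1 2])
qed simp

lemma C_k_on_inner: "C_k_on k U (\<lambda>x. x \<bullet> v)"
proof (cases k)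
  case (Suc m)
  then show ?thesis
    by (auto intro!: exI[of _ "\<lambda>x. v"] derivative_eq_intros C_k_on_const simp: inner_commute)
qed (auto intro!: continuous_intros)

lemma C_k_on_add: "C_k_on k U f \<Longrightarrow> C_k_on k U g \<Longrightarrow> C_k_on k U (\<lambda>x. f x + g x)"
proof (induction k arbitrary: f g)
  case 0 then show ?case by (auto intro: continuous_intros)
next
  case (Suc k)
  from Suc.prems obtain f' g' where
    "\<forall>x\<in>U. (f has_derivative (\<lambda>h. f' x \<bullet> h)) (at x)" "\<forall>e\<in>Basis. C_k_on k U (\<lambda>x. f' x \<bullet> e)"
    "\<forall>x\<in>U. (g has_derivative (\<lambda>h. g' x \<bullet> h)) (at x)" "\<forall>e\<in>Basis. C_k_on k U (\<lambda>x. g' x \<bullet> e)"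
    by auto
  with Suc.IH show ?case
    by (auto intro!: exI[of _ "\<lambda>x. f' x + g' x"] derivative_eq_intros simp: inner_add_left)
qed

lemma C_k_on_mult: "C_k_on k U f \<Longrightarrow> C_k_on k U g \<Longrightarrow> C_k_on k U (\<lambda>x. f x * g x)"
proof (induction k arbitrary: f g)
  case 0 then show ?case by (auto intro: continuous_intros)
next
  case (Suc k)
  from Suc.prems obtain f' g' where
    "\<forall>x\<in>U. (f has_derivative (\<lambda>h. f' x \<bullet> h)) (at x)" "\<forall>e\<in>Basis. C_k_on k U (\<lambda>x. f' x \<bullet> e)"
    "\<forall>x\<in>U. (g has_derivative (\<lambda>h. g' x \<bullet> h)) (at x)" "\<forall>e\<in>Basis. C_k_on k U (\<lambda>x. g' x \<bullet> e)"
    by auto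
  moreover have "C_k_on k U f" "C_k_on k U g"
    using Suc.prems C_k_on_pred by blast+
  ultimately show ?case
    using Suc.IH
    by (auto intro!: exI[of _ "\<lambda>x. f x *\<^sub>R g' x + g x *\<^sub>R f' x"] derivative_eq_intros C_k_on_add
        simp: inner_add_left)
qed

lemma C_k_on_sum: "(\<And>i. i \<in> I \<Longrightarrow> C_k_on k U (f i)) \<Longrightarrow> C_k_on k U (\<lambda>x. \<Sum>i\<in>I. f i x)"
  by (induction I rule: infinite_finite_induct) (auto intro: C_k_on_add C_k_on_const)

lemma C_k_on_S4_cong: "C_k_on_S4 k u \<Longrightarrow> (\<And>x. x \<in> S4 \<Longrightarrow> u x = w x) \<Longrightarrow> C_k_on_S4 k w"
  unfolding C_k_on_S4_def by (metis IntD2)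

lemma C_k_on_imp_S4: "C_k_on k U f \<Longrightarrow> open U \<Longrightarrow> S4 \<subseteq> U \<Longrightarrow> C_k_on_S4 k f"
  unfolding C_k_on_S4_def by blast

lemma C_k_on_S4_le: "C_k_on_S4 n u \<Longrightarrow> m \<le> n \<Longrightarrow> C_k_on_S4 m u"
  unfolding C_k_on_S4_def by (metis C_k_on_le)

lemma C_k_on_S4_const: "C_k_on_S4 k (\<lambda>x. c)"
  using C_k_on_const[of k UNIV] by (rule C_k_on_imp_S4) auto

lemma C_k_on_S4_coord: "C_k_on_S4 k (\<lambda>x. x $ i)"
  using C_k_on_inner[of k UNIV "axis i 1 :: real^5"]
  by (intro C_k_on_imp_S4[of k UNIV]) (auto simp: inner_axis inner_real_def)

lemma C_k_on_S4_add:
  assumes "C_k_on_S4 k u" "C_k_on_S4 k w" shows "C_k_on_S4 k (\<lambda>x. u x + w x)"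
  unfolding C_k_on_S4_def
proof
  fix x :: "real^5" assume "x \<in> S4"
  with assms obtain U f W g where "open U" "x \<in> U" "C_k_on k U f" "\<forall>y\<in>U \<inter> S4. f y = u y"
    "open W" "x \<in> W" "C_k_on k W g" "\<forall>y\<in>W \<inter> S4. g y = w y"
    unfolding C_k_on_S4_def by meson
  then show "\<exists>U f. open U \<and> x \<in> U \<and> C_k_on k U f \<and> (\<forall>y\<in>U \<inter> S4. f y = u y + w y)"
    by (intro exI[of _ "U \<inter> W"] exI[of _ "\<lambda>x. f x + g x"])
      (auto intro!: C_k_on_add intro: C_k_on_subset)
qed

lemma C_k_on_S4_mult:
  assumes "C_k_on_S4 k u" "C_k_on_S4 k w" shows "C_k_on_S4 k (\<lambda>x. u x * w x)"
  unfolding C_k_on_S4_def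
proof
  fix x :: "real^5" assume "x \<in> S4"
  with assms obtain U f W g where "open U" "x \<in> U" "C_k_on k U f" "\<forall>y\<in>U \<inter> S4. f y = u y"
    "open W" "x \<in> W" "C_k_on k W g" "\<forall>y\<in>W \<inter> S4. g y = w y"
    unfolding C_k_on_S4_def by meson
  then show "\<exists>U f. open U \<and> x \<in> U \<and> C_k_on k U f \<and> (\<forall>y\<in>U \<inter> S4. f y = u y * w y)"
    by (intro exI[of _ "U \<inter> W"] exI[of _ "\<lambda>x. f x * g x"])
      (auto intro!: C_k_on_mult intro: C_k_on_subset)
qed

lemma C_k_on_S4_cmult: "C_k_on_S4 k u \<Longrightarrow> C_k_on_S4 k (\<lambda>x. c * u x)"
  by (intro C_k_on_S4_mult C_k_on_S4_const)

lemma C_k_on_S4_diff: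
  assumes "C_k_on_S4 k u" "C_k_on_S4 k w" shows "C_k_on_S4 k (\<lambda>x. u x - w x)"
  using C_k_on_S4_add[OF assms(1) C_k_on_S4_cmult[OF assms(2), of "-1"]] by simp

lemma C_k_on_S4_sum:
  "(\<And>i. i \<in> I \<Longrightarrow> C_k_on_S4 k (f i)) \<Longrightarrow> C_k_on_S4 k (\<lambda>x. \<Sum>i\<in>I. f i x)"
  by (induction I rule: infinite_finite_induct) (auto intro: C_k_on_S4_add C_k_on_S4_const)

lemma C_k_on_S4_continuous:
  assumes "C_k_on_S4 k u" shows "continuous_on S4 u"
  unfolding continuous_on_eq_continuous_within
proof
  fix x :: "real^5" assume x: "x \<in> S4"
  obtain U f where U: "open U" "x \<in> U" "C_k_on 0 U f" "\<forall>y\<in>U \<inter> S4. f y = u y"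
    using C_k_on_S4_le[OF assms le0] x unfolding C_k_on_S4_def by blast
  then have "continuous (at x within S4) f"
    by (simp add: continuous_on_eq_continuous_at continuous_at_imp_continuous_within)
  then show "continuous (at x within S4) u"
    by (rule continuous_transform_within_openin[where S="U \<inter> S4"])
      (use U x in \<open>auto simp: openin_open\<close>)
qed

section \<open>Rotations and derivatives along them\<close>

text \<open>The rotation by the angle \<open>t\<close> in the plane of the coordinates \<open>i\<close> and \<open>j\<close>. Only \<open>i \<noteq> j\<close> gives a
  rotation; letting \<open>i = j\<close> in the definitions, with generator \<open>0\<close>, makes it possible to sum over
  all pairs of indices.\<close>

definition rot :: "5 \<Rightarrow> 5 \<Rightarrow> real \<Rightarrow> real^5 \<Rightarrow> real^5" where
  "rot i j t x = x + ((cos t - 1) * x$i - sin t * x$j) *\<^sub>R axis i 1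
                   + (sin t * x$i + (cos t - 1) * x$j) *\<^sub>R axis j 1"

definition rot_field :: "5 \<Rightarrow> 5 \<Rightarrow> real^5 \<Rightarrow> real^5" where
  "rot_field i j x = x$i *\<^sub>R axis j 1 - x$j *\<^sub>R axis i 1"

lemma rot_0: "rot i j 0 x = x"
  by (simp add: rot_def)

lemma norm_rot:
  assumes "i \<noteq> j" shows "norm (rot i j t x) = norm x"
proof -
  have eq: "sin t * (sin t * a) = a - cos t * (cos t * a)" for a
  proof -
    have "sin t * sin t = 1 - cos t * cos t"
      using sin_cos_squared_add[of t] by (simp add: power2_eq_square algebra_simps)
    then have "(sin t * sin t) * a = (1 - cos t * cos t) * a" by simp
    then show ?thesis by (simp add: algebra_simps)
  qed
  have e: "x \<bullet> axis k 1 = x$k" "axis k 1 \<bullet> x = x$k" "axis k 1 \<bullet> axis k (1::real) = 1" for k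
    by (simp_all add: inner_axis inner_axis' inner_real_def inner_axis_axis)
  have o: "axis i 1 \<bullet> axis j (1::real) = 0" "axis j 1 \<bullet> axis i (1::real) = 0"
    using assms by (simp_all add: inner_axis_axis)
  have "rot i j t x \<bullet> rot i j t x = x \<bullet> x"
    unfolding rot_def by (simp add: inner_add_left inner_add_right e o) (simp add: algebra_simps eq)
  then show ?thesis by (simp add: norm_eq_sqrt_inner)
qed

lemma linear_rot: "linear (rot i j t)"
  unfolding rot_def by (intro linearI) (auto simp: vec_eq_iff algebra_simps)

lemma orthogonal_rot: "i \<noteq> j \<Longrightarrow> orthogonal_transformation (rot i j t)"
  by (simp add: orthogonal_transformation linear_rot norm_rot)

lemma rot_in_S4: "i \<noteq> j \<Longrightarrow> x \<in> S4 \<Longrightarrow> rot i j t x \<in> S4"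
  by (simp add: norm_rot)

lemma rot_has_vector_derivative:
  assumes "i \<noteq> j"
  shows "((\<lambda>t. rot i j t x) has_vector_derivative rot_field i j (rot i j t x)) (at t)"
proof -
  have "((\<lambda>t. rot i j t x) has_vector_derivative
      (- sin t * x$i - cos t * x$j) *\<^sub>R axis i 1 + (cos t * x$i - sin t * x$j) *\<^sub>R axis j 1) (at t)"
    unfolding rot_def by (auto intro!: derivative_eq_intros simp: algebra_simps)
  also have "(- sin t * x$i - cos t * x$j) *\<^sub>R axis i 1 + (cos t * x$i - sin t * x$j) *\<^sub>R axis j 1
      = rot_field i j (rot i j t x)"
    using assms unfolding rot_def rot_field_def by (auto simp: vec_eq_iff axis_def algebra_simps)
  finally show ?thesis .
qed

text \<open>Rotation curves stay in the sphere and run through every tangent direction. They turn a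
  derivative within the sphere into an ordinary derivative in one real variable, and this
  determines it on tangent vectors.\<close>

lemma chain_rot:
  assumes D: "(f has_derivative D) (at (rot i j t x) within S4)" and "i \<noteq> j" "x \<in> S4"
  shows "((\<lambda>t. f (rot i j t x)) has_vector_derivative D (rot_field i j (rot i j t x))) (at t)"
proof -
  have "(f has_derivative D) (at (rot i j t x) within range (\<lambda>t. rot i j t x))"
    using D by (rule has_derivative_subset) (use assms rot_in_S4 in blast)
  then have "(f \<circ> (\<lambda>t. rot i j t x) has_derivative D \<circ> (\<lambda>h. h *\<^sub>R rot_field i j (rot i j t x))) (at t)"
    by (intro diff_chain_within)
      (use rot_has_vector_derivative[OF assms(2)] in \<open>auto simp: has_vector_derivative_def\<close>)
  then show ?thesis
    unfolding has_vector_derivative_def o_def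
    using linear_cmul[OF has_derivative_linear[OF D]] by (simp add: o_def)
qed

lemma derivative_rot_field_unique:
  assumes "(f has_derivative D) (at x within S4)" "(f has_derivative D') (at x within S4)" "x \<in> S4"
  shows "D (rot_field i j x) = D' (rot_field i j x)"
proof (cases "i = j")
  case True
  then have "rot_field i j x = 0" by (simp add: rot_field_def)
  then show ?thesis using assms by (metis has_derivative_linear linear_0)
next
  case False
  then show ?thesis
    using chain_rot[of f D i j 0 x] chain_rot[of f D' i j 0 x] assms
      vector_derivative_unique_at by (fastforce simp: rot_0)
qed

lemma inner_rot_field: "v \<bullet> rot_field i j x = x$i * v$j - x$j * v$i"
  by (simp add: rot_field_def inner_diff_right inner_axis)

text \<open>The squares of the generators, as quadratic forms at a point of the sphere, add up to twice the
  metric on the tangent space (twice because each pair of indices is counted in both orders).\<close>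

lemma sum_rot_field_inner:
  "(\<Sum>i\<in>UNIV. \<Sum>j\<in>UNIV. (v \<bullet> rot_field i j x) * (w \<bullet> rot_field i j x))
     = 2 * ((x \<bullet> x) * (v \<bullet> w) - (x \<bullet> v) * (x \<bullet> w))"
proof -
  have "(\<Sum>i\<in>UNIV. \<Sum>j\<in>UNIV. (v \<bullet> rot_field i j x) * (w \<bullet> rot_field i j x))
     = (\<Sum>i\<in>UNIV. \<Sum>j\<in>UNIV. (x$i * x$i) * (v$j * w$j) - (x$i * w$i) * (x$j * v$j)
         - (x$i * v$i) * (x$j * w$j) + (v$i * w$i) * (x$j * x$j))"
    by (simp add: inner_rot_field algebra_simps)
  also have "\<dots> = 2 * ((x \<bullet> x) * (v \<bullet> w) - (x \<bullet> v) * (x \<bullet> w))"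
    by (simp add: sum.distrib sum_subtractf sum_product[symmetric] inner_vec_def)
  finally show ?thesis .
qed

lemma tangent_rot_field_eq_0:
  assumes "\<And>i j. v \<bullet> rot_field i j x = 0" "v \<bullet> x = 0" "x \<in> S4"
  shows "v = 0"
  using sum_rot_field_inner[of v x v] assms by (auto simp: norm_eq_1 inner_commute)

lemma grad_S4_unique:
  assumes "(u has_derivative (\<lambda>h. g \<bullet> h)) (at x within S4)" "g \<bullet> x = 0" "x \<in> S4"
  shows "grad_S4 u x = g"
  unfolding grad_S4_def
proof (rule the_equality)
  fix g' assume g': "g' \<bullet> x = 0 \<and> (u has_derivative (\<lambda>h. g' \<bullet> h)) (at x within S4)"
  have "g' - g = 0"
  proof (rule tangent_rot_field_eq_0[where x=x])
    show "(g' - g) \<bullet> rot_field i j x = 0" for i j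
      using derivative_rot_field_unique[OF conjunct2[OF g'] assms(1) assms(3)]
      by (simp add: inner_diff_left)
  qed (use g' assms in \<open>auto simp: inner_diff_left\<close>)
  then show "g' = g" by simp
qed (use assms in auto)

lemma grad_S4_cong:
  assumes "\<And>y. y \<in> S4 \<Longrightarrow> u y = w y" "x \<in> S4"
  shows "grad_S4 u x = grad_S4 w x"
proof -
  have "(u has_derivative D) (at x within S4) \<longleftrightarrow> (w has_derivative D) (at x within S4)" for D
    using has_derivative_transform[OF assms(2), of u w D] has_derivative_transform[OF assms(2), of w u D]
    assms(1) by auto
  then show ?thesis by (simp add: grad_S4_def)
qed

text \<open>On the sphere, \<open>f\<close> may be changed by a multiple of \<open>y \<bullet> y - 1\<close>, whose ambient gradient is normal;
  a suitable multiple removes the normal component of the gradient of \<open>f\<close>.\<close>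

lemma has_derivative_within_S4_tangent:
  assumes "(f has_derivative (\<lambda>h. g \<bullet> h)) (at x within S4)" "x \<in> S4"
  shows "(f has_derivative (\<lambda>h. tan_proj x g \<bullet> h)) (at x within S4)"
proof -
  \<comment> \<open>\<open>y \<bullet> y - 1\<close> has gradient \<open>2 * x\<close> at \<open>x\<close>\<close>
  have "((\<lambda>y. f y - (g \<bullet> x) / 2 * (y \<bullet> y - 1)) has_derivative (\<lambda>h. tan_proj x g \<bullet> h))
      (at x within S4)"
    using assms(1) unfolding tan_proj_def
    by (auto intro!: derivative_eq_intros simp: inner_diff_left inner_diff_right inner_commute)
  then show ?thesis
    by (rule has_derivative_transform[OF assms(2), rotated]) (auto simp: norm_eq_1)
qed

text \<open>Functions of class \<open>C\<^sup>k\<^sup>+\<^sup>1\<close> have the gradient that the definite description in the definition of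
  \<^const>\<open>grad_S4\<close> is meant to pick, and its components lose one order of differentiability.\<close>

lemma C_k_on_S4_grad:
  assumes "C_k_on_S4 (Suc k) u"
  shows "\<And>x. x \<in> S4 \<Longrightarrow> (u has_derivative (\<lambda>h. grad_S4 u x \<bullet> h)) (at x within S4)"
    and "\<And>x. x \<in> S4 \<Longrightarrow> grad_S4 u x \<bullet> x = 0"
    and "C_k_on_S4 k (\<lambda>x. grad_S4 u x $ i)"
proof -
  have *: "\<exists>U g. open U \<and> x \<in> U \<and> (\<forall>e\<in>Basis. C_k_on k U (\<lambda>x. g x \<bullet> e)) \<and>
      (\<forall>y\<in>U\<inter>S4. grad_S4 u y = tan_proj y (g y) \<and> grad_S4 u y \<bullet> y = 0 \<and>
        (u has_derivative (\<lambda>h. grad_S4 u y \<bullet> h)) (at y within S4))" if x: "x \<in> S4" for x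
  proof -
    obtain U f where U: "open U" "x \<in> U" "C_k_on (Suc k) U f" "\<forall>y\<in>U \<inter> S4. f y = u y"
      using assms x unfolding C_k_on_S4_def by meson
    obtain g where g: "\<And>y. y\<in>U \<Longrightarrow> (f has_derivative (\<lambda>h. g y \<bullet> h)) (at y)"
      "\<forall>e\<in>Basis. C_k_on k U (\<lambda>x. g x \<bullet> e)" using U(3) by auto
    have "grad_S4 u y = tan_proj y (g y) \<and> grad_S4 u y \<bullet> y = 0 \<and>
        (u has_derivative (\<lambda>h. grad_S4 u y \<bullet> h)) (at y within S4)" if y: "y \<in> U \<inter> S4" for y
    proof -
      have "(f has_derivative (\<lambda>h. tan_proj y (g y) \<bullet> h)) (at y within S4)"
        by (rule has_derivative_within_S4_tangent[OF has_derivative_at_withinI[OF g(1)]]) (use y in auto)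
      then have D: "(u has_derivative (\<lambda>h. tan_proj y (g y) \<bullet> h)) (at y within S4)"
        by (rule has_derivative_transform_eventually)
          (use y U(1,4) in \<open>auto simp: eventually_at_topological intro!: exI[of _ U]\<close>)
      have "tan_proj y (g y) \<bullet> y = 0"
        using y by (auto simp: tan_proj_def inner_diff_left norm_eq_1)
      then show ?thesis using grad_S4_unique[OF D] D y by auto
    qed
    with U g show ?thesis by blast
  qed
  show "(u has_derivative (\<lambda>h. grad_S4 u x \<bullet> h)) (at x within S4)" "grad_S4 u x \<bullet> x = 0"
    if "x \<in> S4" for x using *[OF that] that by blast+
  show "C_k_on_S4 k (\<lambda>x. grad_S4 u x $ i)"
    unfolding C_k_on_S4_def
  proof
    fix x :: "real^5" assume "x \<in> S4"
    from *[OF this] obtain U g where U: "open U" "x \<in> U" "\<forall>e\<in>Basis. C_k_on k U (\<lambda>x. g x \<bullet> e)"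
      "\<forall>y\<in>U\<inter>S4. grad_S4 u y = tan_proj y (g y)" by blast
    have g: "C_k_on k U (\<lambda>x. g x $ j)" for j
      using U(3)[rule_format, of "axis j 1"] by (simp add: inner_axis axis_in_Basis_iff inner_real_def)
    have c: "C_k_on k U (\<lambda>x. x $ j)" for j
      using C_k_on_inner[of k U "axis j 1 :: real^5"] by (simp add: inner_axis inner_real_def)
    have C: "C_k_on k U (\<lambda>y. g y $ i + (-1) * ((\<Sum>j\<in>UNIV. g y $ j * y $ j) * y $ i))"
      by (intro C_k_on_add C_k_on_mult C_k_on_sum C_k_on_const g c)
    have "\<forall>y\<in>U \<inter> S4. g y $ i + (-1) * ((\<Sum>j\<in>UNIV. g y $ j * y $ j) * y $ i) = grad_S4 u y $ i"
      using U(4) by (simp add: tan_proj_def inner_vec_def)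
    with U(1,2) C
    show "\<exists>U f. open U \<and> x \<in> U \<and> C_k_on k U f \<and> (\<forall>y\<in>U \<inter> S4. f y = grad_S4 u y $ i)"
      by (intro exI[of _ U] exI[of _ "\<lambda>y. g y $ i + (-1) * ((\<Sum>j\<in>UNIV. g y $ j * y $ j) * y $ i)"] conjI)
  qed
qed

section \<open>The Laplacian as a sum of squares of rotation fields\<close>

definition rot_deriv :: "5 \<Rightarrow> 5 \<Rightarrow> (real^5 \<Rightarrow> real) \<Rightarrow> real^5 \<Rightarrow> real" where
  "rot_deriv i j u x = grad_S4 u x \<bullet> rot_field i j x"

lemma rot_deriv_cong:
  assumes "\<And>y. y \<in> S4 \<Longrightarrow> u y = w y" "x \<in> S4"
  shows "rot_deriv i j u x = rot_deriv i j w x"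
  using grad_S4_cong[OF assms] by (simp add: rot_deriv_def)

lemma rot_deriv_eq:
  assumes D: "(f has_derivative D) (at x within S4)" and x: "x \<in> S4"
  shows "rot_deriv i j f x = D (rot_field i j x)"
proof -
  have "D = (\<lambda>h. adjoint D 1 \<bullet> h)"
    using adjoint_works[OF has_derivative_linear[OF D], of _ 1]
    by (simp add: inner_commute fun_eq_iff)
  with D have "(f has_derivative (\<lambda>h. adjoint D 1 \<bullet> h)) (at x within S4)"
    by simp
  then have T: "(f has_derivative (\<lambda>h. tan_proj x (adjoint D 1) \<bullet> h)) (at x within S4)"
    using x by (rule has_derivative_within_S4_tangent)
  have "tan_proj x (adjoint D 1) \<bullet> x = 0"
    using x by (simp add: tan_proj_def inner_diff_left norm_eq_1)
  from grad_S4_unique[OF T this x] show ?thesis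
    using derivative_rot_field_unique[OF T D x] by (simp add: rot_deriv_def)
qed

lemma C_k_on_S4_rot_deriv:
  assumes "C_k_on_S4 (Suc k) u" shows "C_k_on_S4 k (rot_deriv i j u)"
proof -
  have "C_k_on_S4 k (\<lambda>x. x$i * grad_S4 u x$j - x$j * grad_S4 u x$i)"
    by (intro C_k_on_S4_diff C_k_on_S4_mult C_k_on_S4_coord C_k_on_S4_grad(3)[OF assms])
  then show ?thesis by (simp add: rot_deriv_def[abs_def] inner_rot_field)
qed

lemma linear_rot_field: "linear (rot_field i j)"
  unfolding rot_field_def by (intro linearI) (auto simp: algebra_simps)

lemma sum_rot_field_rot_field:
  "(\<Sum>i\<in>UNIV. \<Sum>j\<in>UNIV. v \<bullet> rot_field i j (rot_field i j x)) = - 8 * (v \<bullet> x)"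
proof -
  have "v \<bullet> rot_field i j (rot_field i j x)
      = (if i = j then 2 * (v$i * x$i) else 0) - v$j * x$j - v$i * x$i" for i j
    by (simp add: inner_rot_field) (simp add: rot_field_def axis_def)
  then have "(\<Sum>i\<in>UNIV. \<Sum>j\<in>UNIV. v \<bullet> rot_field i j (rot_field i j x))
      = (\<Sum>i\<in>UNIV. \<Sum>j\<in>UNIV. (if i = j then 2 * (v$i * x$i) else 0) - v$j * x$j - v$i * x$i)"
    by simp
  also have "\<dots> = - 8 * (\<Sum>i\<in>UNIV. v$i * x$i)"
    by (simp add: sum_subtractf sum_distrib_left[symmetric] sum_negf)
  finally show ?thesis by (simp add: inner_vec_def)
qed

text \<open>The left-hand side is the trace of \<open>D\<close> over the tangent space. The generators at \<open>x\<close> form a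
  tight frame of this space, as in \<open>sum_rot_field_inner\<close>, so they compute the trace as well as an orthonormal
  basis does.\<close>

lemma trace_tan_proj:
  fixes D :: "real^5 \<Rightarrow> real^5"
  assumes D: "linear D" and x: "x \<in> S4"
  shows "trace (matrix (\<lambda>v. tan_proj x (D (tan_proj x v))))
    = 1/2 * (\<Sum>i\<in>UNIV. \<Sum>j\<in>UNIV. D (rot_field i j x) \<bullet> rot_field i j x)"
proof -
  define d where "d k = D (axis k 1)" for k
  have lin: "D (v + w) = D v + D w" "D (v - w) = D v - D w" "D (c *\<^sub>R v) = c *\<^sub>R D v" for v w c
    using D by (auto simp: linear_add linear_diff linear_cmul)
  have Dx: "D x = (\<Sum>k\<in>UNIV. x$k *\<^sub>R d k)"
    unfolding d_def using linear_sum[OF D] linear_cmul[OF D] basis_expansion[of x]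
    by (metis (no_types, lifting) scalar_mult_eq_scaleR sum.cong)
  have xx: "x \<bullet> x = 1" using x by (simp add: norm_eq_1)
  have S1: "(\<Sum>k\<in>UNIV. x$k * (d k \<bullet> x)) = D x \<bullet> x"
    by (simp add: Dx inner_sum_left)
  have S2: "(\<Sum>k\<in>UNIV. x$k * (D x)$k) = D x \<bullet> x" by (simp add: inner_vec_def mult.commute)
  have S3: "(\<Sum>k\<in>UNIV. x$k * x$k) = 1" using xx by (simp add: inner_vec_def)
  have "trace (matrix (\<lambda>v. tan_proj x (D (tan_proj x v))))
      = (\<Sum>k\<in>UNIV. tan_proj x (D (tan_proj x (axis k 1))) $ k)"
    by (simp add: trace_def matrix_def)
  also have "\<dots> = (\<Sum>k\<in>UNIV. d k $ k - x$k * (d k \<bullet> x) - x$k * (D x)$k + (x$k * x$k) * (D x \<bullet> x))"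
    by (intro sum.cong refl)
      (simp add: tan_proj_def lin inner_axis' inner_diff_left d_def algebra_simps)
  also have "\<dots> = (\<Sum>k\<in>UNIV. d k $ k) - D x \<bullet> x"
    by (simp add: sum.distrib sum_subtractf S1 S2 sum_distrib_right[symmetric] S3)
  finally have T: "trace (matrix (\<lambda>v. tan_proj x (D (tan_proj x v)))) = (\<Sum>k\<in>UNIV. d k $ k) - D x \<bullet> x" .
  have "(\<Sum>i\<in>UNIV. \<Sum>j\<in>UNIV. D (rot_field i j x) \<bullet> rot_field i j x)
     = (\<Sum>i\<in>UNIV. \<Sum>j\<in>UNIV. (x$i * x$i) * d j $ j - x$j * (x$i * d j $ i)
          - x$i * (x$j * d i $ j) + (x$j * x$j) * d i $ i)"
    unfolding inner_rot_field by (simp add: rot_field_def lin d_def[symmetric] algebra_simps)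
  also have "\<dots> = 2 * (\<Sum>k\<in>UNIV. d k $ k) - (\<Sum>i\<in>UNIV. \<Sum>j\<in>UNIV. x$j * (x$i * d j $ i))
       - (\<Sum>i\<in>UNIV. \<Sum>j\<in>UNIV. x$i * (x$j * d i $ j))"
    by (simp add: sum.distrib sum_subtractf sum_distrib_left[symmetric] sum_distrib_right[symmetric] S3)
  also have "(\<Sum>i\<in>UNIV. \<Sum>j\<in>UNIV. x$i * (x$j * d i $ j)) = D x \<bullet> x"
    unfolding S1[symmetric]
    by (simp add: inner_vec_def sum_distrib_left sum_distrib_right mult_ac)
  also have "(\<Sum>i\<in>UNIV. \<Sum>j\<in>UNIV. x$j * (x$i * d j $ i)) = D x \<bullet> x"
    unfolding S1[symmetric]
    by (subst sum.swap) (simp add: inner_vec_def sum_distrib_left sum_distrib_right mult_ac)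
  finally show ?thesis using T by simp
qed

text \<open>The Laplacian is the Casimir operator of the rotation group. Differentiating
  \<open>grad u \<bullet> rot_field i j\<close> along \<open>rot_field i j\<close> gives the frame expression for the divergence of the gradient and a
  term with \<open>rot_field i j (rot_field i j x)\<close>; the latter add up to a normal vector, to which the gradient
  is orthogonal.\<close>

lemma laplace_S4_eq_rot_deriv:
  assumes u: "C_k_on_S4 2 u" and x: "x \<in> S4"
  shows "laplace_S4 u x = - 1/2 * (\<Sum>i\<in>UNIV. \<Sum>j\<in>UNIV. rot_deriv i j (rot_deriv i j u) x)"
proof -
  define X where "X = grad_S4 u"
  define D where "D = frechet_derivative X (at x within S4)"
  have u2: "C_k_on_S4 (Suc (Suc 0)) u" using u by (simp add: numeral_2_eq_2)
  have "(\<lambda>y. X y \<bullet> e) differentiable (at x within S4)" if e: "e \<in> Basis" for e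
  proof -
    obtain i where ei: "e = axis i (1::real)" using e unfolding Basis_vec_def by auto
    have eq: "(\<lambda>y. X y \<bullet> e) = (\<lambda>y. grad_S4 u y $ i)"
      unfolding ei X_def by (simp add: inner_axis)
    have "C_k_on_S4 (Suc 0) (\<lambda>y. grad_S4 u y $ i)"
      by (rule C_k_on_S4_grad(3)[OF u2])
    from C_k_on_S4_grad(1)[OF this x] show ?thesis
      unfolding eq by (rule differentiableI)
  qed
  then have "X differentiable (at x within S4)"
    by (subst differentiable_componentwise_within) blast
  then have D: "(X has_derivative D) (at x within S4)"
    by (simp add: D_def frechet_derivative_works)
  have "rot_deriv i j (rot_deriv i j u) x = D (rot_field i j x) \<bullet> rot_field i j x + X x \<bullet> rot_field i j (rot_field i j x)"
    for i j
  proof -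
    have R: "(rot_field i j has_derivative rot_field i j) (at x within S4)"
      using linear_rot_field by (simp add: linear_imp_has_derivative)
    have "(rot_deriv i j u has_derivative (\<lambda>h. X x \<bullet> rot_field i j h + D h \<bullet> rot_field i j x)) (at x within S4)"
      unfolding rot_deriv_def[abs_def] X_def[symmetric] by (intro has_derivative_inner D R)
    from rot_deriv_eq[OF this x, where i=i and j=j] show ?thesis by (simp only: add.commute)
  qed
  then have "(\<Sum>i\<in>UNIV. \<Sum>j\<in>UNIV. rot_deriv i j (rot_deriv i j u) x)
      = (\<Sum>i\<in>UNIV. \<Sum>j\<in>UNIV. D (rot_field i j x) \<bullet> rot_field i j x) - 8 * (X x \<bullet> x)"
    by (simp add: sum.distrib sum_rot_field_rot_field)
  also have "X x \<bullet> x = 0"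
    unfolding X_def by (rule C_k_on_S4_grad(2)[OF u2 x])
  finally have "(\<Sum>i\<in>UNIV. \<Sum>j\<in>UNIV. rot_deriv i j (rot_deriv i j u) x)
      = 2 * trace (matrix (\<lambda>v. tan_proj x (D (tan_proj x v))))"
    by (simp add: trace_tan_proj[OF has_derivative_linear[OF D] x])
  moreover have "laplace_S4 u x = - trace (matrix (\<lambda>v. tan_proj x (D (tan_proj x v))))"
    unfolding laplace_S4_def div_S4_def cov_deriv_S4_def D_def X_def ..
  ultimately show ?thesis by simp
qed

lemma laplace_S4_cong:
  assumes "C_k_on_S4 2 u" "\<And>y. y \<in> S4 \<Longrightarrow> u y = w y" "x \<in> S4"
  shows "laplace_S4 u x = laplace_S4 w x"
proof -
  have w: "C_k_on_S4 2 w" using assms(1,2) by (rule C_k_on_S4_cong)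
  have "rot_deriv i j (rot_deriv i j u) x = rot_deriv i j (rot_deriv i j w) x" for i j
    by (intro rot_deriv_cong assms)
  then show ?thesis
    by (simp only: laplace_S4_eq_rot_deriv[OF assms(1,3)] laplace_S4_eq_rot_deriv[OF w assms(3)])
qed

lemma C_k_on_S4_laplace:
  assumes "C_k_on_S4 (k + 2) u" shows "C_k_on_S4 k (laplace_S4 u)"
proof -
  have u: "C_k_on_S4 (Suc (Suc k)) u" "C_k_on_S4 2 u"
    using assms C_k_on_S4_le[OF assms, of 2] by auto
  have "C_k_on_S4 k (\<lambda>x. - 1/2 * (\<Sum>i\<in>UNIV. \<Sum>j\<in>UNIV. rot_deriv i j (rot_deriv i j u) x))"
    by (intro C_k_on_S4_cmult C_k_on_S4_sum C_k_on_S4_rot_deriv u(1))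
  then show ?thesis
    by (rule C_k_on_S4_cong) (simp only: laplace_S4_eq_rot_deriv[OF u(2)])
qed

text \<open>The coordinate function \<open>p \<bullet> x\<close> is an eigenfunction of eigenvalue \<open>4\<close>, and its gradient has squared
  norm \<open>1 - (p \<bullet> x)\<^sup>2\<close>; the formula is the chain rule for \<open>F\<close>.\<close>

lemma laplace_S4_zonal:
  assumes p: "p \<in> S4" and x: "x \<in> S4"
    and C: "C_k_on_S4 2 (\<lambda>y. F (p \<bullet> y))"
    and F: "\<And>t. \<bar>t\<bar> \<le> 1 \<Longrightarrow> (F has_real_derivative F' t) (at t)"
    and F': "\<And>t. \<bar>t\<bar> \<le> 1 \<Longrightarrow> (F' has_real_derivative F'' t) (at t)"
  shows "laplace_S4 (\<lambda>y. F (p \<bullet> y)) x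
    = 4 * (p \<bullet> x) * F' (p \<bullet> x) - (1 - (p \<bullet> x)\<^sup>2) * F'' (p \<bullet> x)"
proof -
  have bd: "\<bar>p \<bullet> y\<bar> \<le> 1" if "y \<in> S4" for y
    using Cauchy_Schwarz_ineq2[of p y] p that by simp
  have lin: "((\<lambda>y. p \<bullet> y) has_derivative (\<lambda>h. p \<bullet> h)) (at y within S4)" for y
    by (rule bounded_linear_imp_has_derivative[OF bounded_linear_inner_right])
  have chain: "((\<lambda>y. G (p \<bullet> y)) has_derivative (\<lambda>h. G' (p \<bullet> y) * (p \<bullet> h))) (at y within S4)"
    if "y \<in> S4" "\<And>t. \<bar>t\<bar> \<le> 1 \<Longrightarrow> (G has_real_derivative G' t) (at t)" for y G G'
    using has_derivative_compose[OF lin, of G "\<lambda>h. G' (p \<bullet> y) * h" y]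
      that(2)[OF bd[OF that(1)]] by (simp add: has_field_derivative_def)
  have 1: "rot_deriv i j (\<lambda>y. F (p \<bullet> y)) y = F' (p \<bullet> y) * (p \<bullet> rot_field i j y)" if "y \<in> S4" for y i j
    by (rule rot_deriv_eq[OF chain]) (use that F in auto)
  have 2: "rot_deriv i j (rot_deriv i j (\<lambda>y. F (p \<bullet> y))) x
     = F'' (p \<bullet> x) * ((p \<bullet> rot_field i j x) * (p \<bullet> rot_field i j x))
       + F' (p \<bullet> x) * (p \<bullet> rot_field i j (rot_field i j x))" for i j
  proof -
    have R: "((\<lambda>y. p \<bullet> rot_field i j y) has_derivative (\<lambda>h. p \<bullet> rot_field i j h)) (at x within S4)"
      using linear_rot_field by (intro has_derivative_inner_right linear_imp_has_derivative)
    have "((\<lambda>y. F' (p \<bullet> y) * (p \<bullet> rot_field i j y)) has_derivative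
       (\<lambda>h. F' (p \<bullet> x) * (p \<bullet> rot_field i j h) + (F'' (p \<bullet> x) * (p \<bullet> h)) * (p \<bullet> rot_field i j x)))
       (at x within S4)"
      by (intro has_derivative_mult R chain x F')
    from rot_deriv_eq[OF this x, where i=i and j=j] have "rot_deriv i j (\<lambda>y. F' (p \<bullet> y) * (p \<bullet> rot_field i j y)) x
      = F' (p \<bullet> x) * (p \<bullet> rot_field i j (rot_field i j x))
       + F'' (p \<bullet> x) * (p \<bullet> rot_field i j x) * (p \<bullet> rot_field i j x)" .
    moreover have "rot_deriv i j (rot_deriv i j (\<lambda>y. F (p \<bullet> y))) x
      = rot_deriv i j (\<lambda>y. F' (p \<bullet> y) * (p \<bullet> rot_field i j y)) x"
      by (rule rot_deriv_cong[OF 1 x])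
    ultimately show ?thesis by (simp only: mult.assoc add.commute)
  qed
  have "(\<Sum>i\<in>UNIV. \<Sum>j\<in>UNIV. rot_deriv i j (rot_deriv i j (\<lambda>y. F (p \<bullet> y))) x)
     = F'' (p \<bullet> x) * (2 * (1 - (p \<bullet> x)\<^sup>2)) + F' (p \<bullet> x) * (- 8 * (p \<bullet> x))"
    unfolding 2 sum.distrib sum_distrib_left[symmetric] sum_rot_field_inner sum_rot_field_rot_field
    using p x by (simp add: norm_eq_1 power2_eq_square inner_commute)
  then show ?thesis
    using laplace_S4_eq_rot_deriv[OF C x] by (simp add: algebra_simps)
qed

section \<open>The rotation invariant mean on the sphere\<close>

text \<open>The value at the origin is an arbitrary point of the sphere, so that the map is total into the
  sphere; the origin is a null set.\<close>

definition sphere_proj :: "real^5 \<Rightarrow> real^5" where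
  "sphere_proj x = (if x = 0 then axis 1 1 else x /\<^sub>R norm x)"

text \<open>The normalised surface measure, obtained by projecting the uniform measure of the unit ball
  radially. Its rotation invariance is then inherited from Lebesgue measure. It lives on the sphere
  itself, so functions that are continuous on the sphere only are measurable.\<close>

definition S4_unif :: "(real^5) measure" where
  "S4_unif = distr (uniform_measure lborel (ball 0 1)) (restrict_space borel S4) sphere_proj"

lemma space_S4_unif [simp]: "space S4_unif = S4"
  by (simp add: S4_unif_def space_restrict_space)

lemma sphere_proj_measurable: "sphere_proj \<in> borel \<rightarrow>\<^sub>M restrict_space borel S4"
proof (rule measurable_restrict_space2)
  show "sphere_proj \<in> space borel \<rightarrow> S4"
    by (auto simp: sphere_proj_def norm_axis_1)
  have "(\<lambda>x::real^5. x /\<^sub>R norm x) \<in> borel_measurable borel" by measurable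
  then show "sphere_proj \<in> borel_measurable borel"
    unfolding sphere_proj_def[abs_def] by measurable
qed

lemma emeasure_ball_01: "emeasure lborel (ball (0::real^5) 1) \<noteq> 0"
    "emeasure lborel (ball (0::real^5) 1) \<noteq> \<infinity>"
  using emeasure_lborel_ball_finite[of "0::real^5" 1] open_not_negligible[of "ball (0::real^5) 1"]
  by (auto simp: negligible_iff_emeasure0 top.not_eq_extremum)

lemma measurable_uniform_lborel:
  "f \<in> borel \<rightarrow>\<^sub>M N \<Longrightarrow> f \<in> uniform_measure lborel A \<rightarrow>\<^sub>M N"
proof -
  have "(uniform_measure lborel A \<rightarrow>\<^sub>M N) = (borel \<rightarrow>\<^sub>M N)"
    by (rule measurable_cong_sets) simp_all
  then show "f \<in> borel \<rightarrow>\<^sub>M N \<Longrightarrow> f \<in> uniform_measure lborel A \<rightarrow>\<^sub>M N" by simp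
qed

lemma prob_space_uniform_ball: "prob_space (uniform_measure lborel (ball (0::real^5) 1))"
  by (intro prob_space_uniform_measure emeasure_ball_01)

lemma prob_space_S4_unif: "prob_space S4_unif"
  unfolding S4_unif_def
  by (intro prob_space.prob_space_distr prob_space_uniform_ball measurable_uniform_lborel
      sphere_proj_measurable)

lemma lborel_distr_orthogonal:
  fixes R :: "real^'n::{finite,wellorder} \<Rightarrow> real^'n::_"
  assumes R: "orthogonal_transformation R"
  shows "distr lborel borel R = lborel"
proof (rule lborel_eqI[symmetric])
  have meas: "R \<in> borel_measurable borel"
    by (intro borel_measurable_continuous_onI linear_continuous_on
        linear_conv_bounded_linear[THEN iffD1] orthogonal_transformation_linear R)
  fix l u :: "real^'n::_" assume lu: "\<And>b. b \<in> Basis \<Longrightarrow> l \<bullet> b \<le> u \<bullet> b"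
  have g: "orthogonal_transformation (inv R)" "bij R"
    using R by (auto intro: orthogonal_transformation_inv orthogonal_transformation_bij)
  have pre: "R -` box l u = inv R ` box l u"
    using bij_vimage_eq_inv_image[OF g(2)] .
  have "emeasure (distr lborel borel R) (box l u) = emeasure lborel (R -` box l u)"
    using meas by (simp add: emeasure_distr)
  also have "\<dots> = emeasure lebesgue (R -` box l u)"
    using measurable_sets[OF meas, of "box l u"] by simp
  also have "\<dots> = measure lebesgue (inv R ` box l u)"
    unfolding pre by (rule emeasure_eq_measure2)
      (rule measurable_orthogonal_image[OF g(1) lmeasurable_box])
  also have "\<dots> = measure lebesgue (box l u)"
    by (simp add: measure_orthogonal_image[OF g(1) lmeasurable_box])
  also have "\<dots> = (\<Prod>b\<in>Basis. (u - l) \<bullet> b)"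
    using lu by (simp add: emeasure_lborel_box_eq)
  finally show "emeasure (distr lborel borel R) (box l u) = (\<Prod>b\<in>Basis. (u - l) \<bullet> b)" .
qed simp

lemma uniform_ball_distr_orthogonal:
  fixes R :: "real^5 \<Rightarrow> real^5"
  assumes R: "orthogonal_transformation R"
  shows "distr (uniform_measure lborel (ball 0 1)) borel R = uniform_measure lborel (ball 0 1)"
proof (rule measure_eqI)
  have meas: "R \<in> borel_measurable borel"
    by (intro borel_measurable_continuous_onI linear_continuous_on
        linear_conv_bounded_linear[THEN iffD1] orthogonal_transformation_linear R)
  fix A assume "A \<in> sets (distr (uniform_measure lborel (ball 0 1)) borel R)"
  then have A: "A \<in> sets borel" by simp
  have RA: "R -` A \<in> sets borel" using measurable_sets[OF meas A] by simp
  have "ball 0 1 \<inter> R -` A = R -` (ball 0 1 \<inter> A)"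
    using orthogonal_transformation_norm[OF R] by auto
  moreover have "emeasure lborel (R -` (ball 0 1 \<inter> A)) = emeasure (distr lborel borel R) (ball 0 1 \<inter> A)"
    using meas A by (subst emeasure_distr) auto
  ultimately have "emeasure lborel (ball 0 1 \<inter> R -` A) = emeasure lborel (ball 0 1 \<inter> A)"
    by (simp add: lborel_distr_orthogonal[OF R])
  then show "emeasure (distr (uniform_measure lborel (ball 0 1)) borel R) A
      = emeasure (uniform_measure lborel (ball 0 1)) A"
    using meas A RA by (subst emeasure_distr) (auto simp: emeasure_uniform_measure)
qed simp

lemma integral_S4_unif_orthogonal:
  fixes h :: "real^5 \<Rightarrow> real"
  assumes R: "orthogonal_transformation R" and h: "h \<in> borel_measurable S4_unif"
  shows "(\<integral>x. h (R x) \<partial>S4_unif) = (\<integral>x. h x \<partial>S4_unif)"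
proof -
  let ?U = "uniform_measure lborel (ball (0::real^5) 1)"
  have h': "h \<in> borel_measurable (restrict_space borel S4)"
    using h by (simp add: S4_unif_def)
  have cR: "R \<in> borel_measurable borel"
    by (intro borel_measurable_continuous_onI linear_continuous_on
        linear_conv_bounded_linear[THEN iffD1] orthogonal_transformation_linear R)
  have RS: "R \<in> restrict_space borel S4 \<rightarrow>\<^sub>M restrict_space borel S4"
    by (intro measurable_restrict_space3 cR) (simp add: orthogonal_transformation_norm[OF R] Pi_iff)
  have pU: "sphere_proj \<in> ?U \<rightarrow>\<^sub>M restrict_space borel S4"
    by (intro measurable_uniform_lborel sphere_proj_measurable)
  have RU: "R \<in> ?U \<rightarrow>\<^sub>M borel"
    by (intro measurable_uniform_lborel cR)
  have hR: "(\<lambda>x. h (R x)) \<in> borel_measurable (restrict_space borel S4)"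
    using measurable_compose[OF RS h'] .
  have hp: "(\<lambda>x. h (sphere_proj x)) \<in> borel_measurable borel"
    using measurable_compose[OF sphere_proj_measurable h'] .
  have "AE x in lborel. x \<noteq> (0::real^5)"
    by (rule AE_lborel_singleton)
  then have ae: "AE x in ?U. x \<noteq> 0"
    by (intro AE_uniform_measureI) auto
  have "(\<integral>x. h (R x) \<partial>S4_unif) = (\<integral>x. h (R (sphere_proj x)) \<partial>?U)"
    unfolding S4_unif_def by (rule integral_distr[OF pU hR])
  also have "\<dots> = (\<integral>x. h (sphere_proj (R x)) \<partial>?U)"
  proof (rule integral_cong_AE)
    show "(\<lambda>x. h (R (sphere_proj x))) \<in> borel_measurable ?U"
      by (rule measurable_compose[OF pU hR])
    show "(\<lambda>x. h (sphere_proj (R x))) \<in> borel_measurable ?U"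
      by (rule measurable_compose[OF RU hp])
    show "AE x in ?U. h (R (sphere_proj x)) = h (sphere_proj (R x))"
      using ae
    proof eventually_elim
      case (elim x)
      then have "R x \<noteq> 0" using orthogonal_transformation_norm[OF R, of x] by auto
      with elim show ?case
        using orthogonal_transformation_norm[OF R, of x]
        by (simp add: sphere_proj_def orthogonal_transformation_scaleR[OF R])
    qed
  qed
  also have "\<dots> = (\<integral>x. h (sphere_proj x) \<partial>distr ?U borel R)"
    by (rule integral_distr[OF RU hp, symmetric])
  also have "\<dots> = (\<integral>x. h x \<partial>S4_unif)"
    unfolding uniform_ball_distr_orthogonal[OF R] S4_unif_def by (rule integral_distr[OF pU h', symmetric])
  finally show ?thesis .
qed

lemma measurable_S4_unif:
  "continuous_on S4 h \<Longrightarrow> h \<in> borel_measurable S4_unif"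
  using borel_measurable_continuous_on_restrict[of S4 h] by (simp add: S4_unif_def)

lemma bounded_on_S4:
  fixes h :: "real^5 \<Rightarrow> real"
  assumes "continuous_on S4 h" obtains B where "B > 0" "\<And>x. x \<in> S4 \<Longrightarrow> \<bar>h x\<bar> \<le> B"
  using compact_imp_bounded[OF compact_continuous_image[OF assms compact_sphere]]
  by (auto simp: bounded_pos)

lemma integrable_S4_unif:
  fixes h :: "real^5 \<Rightarrow> real"
  assumes "continuous_on S4 h" shows "integrable S4_unif h"
proof -
  interpret prob_space S4_unif by (rule prob_space_S4_unif)
  obtain B where "\<And>x. x \<in> S4 \<Longrightarrow> \<bar>h x\<bar> \<le> B" using bounded_on_S4[OF assms] by blast
  then show ?thesis
    by (intro integrable_const_bound[of h B] measurable_S4_unif assms AE_I2) auto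
qed

lemma integral_S4_unif_const [simp]: "(\<integral>x. c \<partial>S4_unif) = (c::real)"
proof -
  interpret prob_space S4_unif by (rule prob_space_S4_unif)
  show ?thesis using prob_space by simp
qed

lemma integral_S4_unif_cong:
  "(\<And>x. x \<in> S4 \<Longrightarrow> f x = g x) \<Longrightarrow> (\<integral>x. f x \<partial>S4_unif) = (\<integral>x. g x \<partial>S4_unif)"
  for f g :: "real^5 \<Rightarrow> real"
  by (rule Bochner_Integration.integral_cong) auto

lemma rotation_curve_derivative:
  assumes "C_k_on_S4 (Suc 0) h" "x \<in> S4" "i \<noteq> j"
  shows "((\<lambda>t. h (rot i j t x)) has_real_derivative rot_deriv i j h (rot i j t x)) (at t)"
  unfolding has_real_derivative_iff_has_vector_derivative rot_deriv_def
  by (rule chain_rot) (use assms C_k_on_S4_grad(1)[OF assms(1)] rot_in_S4 in auto)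

text \<open>Differentiate the constant function \<open>t \<mapsto> \<integral> h (rot i j t x)\<close> at \<open>t = 0\<close>. This replaces the divergence
  theorem.\<close>

lemma integral_rot_deriv:
  assumes h: "C_k_on_S4 (Suc 0) h"
  shows "(\<integral>x. rot_deriv i j h x \<partial>S4_unif) = 0"
proof (cases "i = j")
  case True
  then show ?thesis by (simp add: rot_deriv_def rot_field_def)
next
  case False
  have ch: "continuous_on S4 h" by (rule C_k_on_S4_continuous[OF h])
  have cr: "continuous_on S4 (rot_deriv i j h)"
    by (rule C_k_on_S4_continuous[OF C_k_on_S4_rot_deriv[OF h]])
  obtain B where B: "\<And>x. x \<in> S4 \<Longrightarrow> \<bar>rot_deriv i j h x\<bar> \<le> B" using bounded_on_S4[OF cr] by blast
  \<comment> \<open>difference quotients of \<open>h\<close> along the rotation curves\<close>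
  define s where "s n x = (h (rot i j (1 / Suc n) x) - h x) * Suc n" for n x
  have chr: "continuous_on S4 (\<lambda>x. h (rot i j t x))" for t
    by (intro continuous_on_compose2[OF ch])
      (use rot_in_S4[OF False] linear_continuous_on[OF linear_rot[unfolded linear_conv_bounded_linear]] in auto)
  have cs: "continuous_on S4 (s n)" for n
    unfolding s_def[abs_def] by (intro continuous_intros chr ch)
  have 0: "(\<integral>x. s n x \<partial>S4_unif) = 0" for n
    unfolding s_def using integral_S4_unif_orthogonal[OF orthogonal_rot[OF False] measurable_S4_unif[OF ch]]
    by (simp add: Bochner_Integration.integral_diff integrable_S4_unif chr ch)
  have "(\<lambda>n. \<integral>x. s n x \<partial>S4_unif) \<longlonglongrightarrow> (\<integral>x. rot_deriv i j h x \<partial>S4_unif)"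
  proof (rule integral_dominated_convergence[where w="\<lambda>_. B"])
    show "AE x in S4_unif. (\<lambda>n. s n x) \<longlonglongrightarrow> rot_deriv i j h x"
    proof (rule AE_I2)
      fix x assume "x \<in> space S4_unif"
      then have "((\<lambda>t. h (rot i j t x)) has_real_derivative rot_deriv i j h (rot i j 0 x)) (at 0)"
        by (intro rotation_curve_derivative h False) auto
      then have "(\<lambda>t. (h (rot i j t x) - h x) / t) \<midarrow>0\<rightarrow> rot_deriv i j h x"
        by (simp add: DERIV_def rot_0)
      moreover have "filterlim (\<lambda>n. 1 / real (Suc n)) (at 0) sequentially"
        by (rule filterlim_atI[OF LIMSEQ_Suc[OF lim_1_over_n]]) auto
      ultimately have "(\<lambda>n. (h (rot i j (1 / real (Suc n)) x) - h x) / (1 / real (Suc n)))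
          \<longlonglongrightarrow> rot_deriv i j h x"
        by (rule filterlim_compose)
      then show "(\<lambda>n. s n x) \<longlonglongrightarrow> rot_deriv i j h x" by (simp add: s_def)
    qed
    show "AE x in S4_unif. norm (s n x) \<le> B" for n
    proof (rule AE_I2)
      fix x assume "x \<in> space S4_unif"
      then have x: "x \<in> S4" by simp
      obtain z where "h (rot i j (1 / Suc n) x) - h (rot i j 0 x)
          = (1 / Suc n - 0) * rot_deriv i j h (rot i j z x)"
        using MVT2[of 0 "1 / Suc n" "\<lambda>t. h (rot i j t x)" "\<lambda>t. rot_deriv i j h (rot i j t x)"]
          rotation_curve_derivative[OF h x False] by auto
      then show "norm (s n x) \<le> B"
        using B[OF rot_in_S4[OF False x, of z]] by (simp add: s_def rot_0)
    qed
    interpret prob_space S4_unif by (rule prob_space_S4_unif)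
    show "integrable S4_unif (\<lambda>_. B)" by simp
  qed (use measurable_S4_unif cs cr in auto)
  then show ?thesis unfolding 0 by (simp add: LIMSEQ_const_iff)
qed

lemma rot_deriv_mult:
  assumes "C_k_on_S4 (Suc 0) f" "C_k_on_S4 (Suc 0) g" "x \<in> S4"
  shows "rot_deriv i j (\<lambda>x. f x * g x) x = f x * rot_deriv i j g x + rot_deriv i j f x * g x"
  by (subst rot_deriv_eq[OF has_derivative_mult[OF C_k_on_S4_grad(1)[OF assms(1)] C_k_on_S4_grad(1)[OF assms(2)]]])
    (use assms in \<open>auto simp: rot_deriv_def\<close>)

lemma rot_deriv_diff:
  assumes "C_k_on_S4 (Suc 0) f" "C_k_on_S4 (Suc 0) g" "x \<in> S4"
  shows "rot_deriv i j (\<lambda>x. f x - g x) x = rot_deriv i j f x - rot_deriv i j g x"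
  by (subst rot_deriv_eq[OF has_derivative_diff[OF C_k_on_S4_grad(1)[OF assms(1)] C_k_on_S4_grad(1)[OF assms(2)]]])
    (use assms in \<open>auto simp: rot_deriv_def\<close>)

lemma continuous_on_laplace_S4: "C_k_on_S4 2 u \<Longrightarrow> continuous_on S4 (laplace_S4 u)"
  using C_k_on_S4_continuous[OF C_k_on_S4_laplace, of 0 u] by (simp add: numeral_2_eq_2)

text \<open>The difference of the integrands is, up to the factor \<open>- 1/2\<close>, a sum of derivatives
  \<open>rot_deriv i j (f * rot_deriv i j g - g * rot_deriv i j f)\<close>, each of integral \<open>0\<close>.\<close>

lemma Green_S4:
  assumes f: "C_k_on_S4 2 f" and g: "C_k_on_S4 2 g"
  shows "(\<integral>x. f x * laplace_S4 g x \<partial>S4_unif) = (\<integral>x. g x * laplace_S4 f x \<partial>S4_unif)"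
proof -
  define q where "q i j x = f x * rot_deriv i j g x - g x * rot_deriv i j f x" for i j x
  have f2: "C_k_on_S4 (Suc (Suc 0)) f" and g2: "C_k_on_S4 (Suc (Suc 0)) g"
    using f g by (simp_all add: numeral_2_eq_2)
  have f1: "C_k_on_S4 (Suc 0) f" and g1: "C_k_on_S4 (Suc 0) g"
    using C_k_on_S4_le[OF f] C_k_on_S4_le[OF g] by auto
  note rf = C_k_on_S4_rot_deriv[OF f2] and rg = C_k_on_S4_rot_deriv[OF g2]
  have q1: "C_k_on_S4 (Suc 0) (q i j)" for i j
    unfolding q_def[abs_def] by (intro C_k_on_S4_diff C_k_on_S4_mult f1 g1 rf rg)
  have rq: "rot_deriv i j (q i j) x = f x * rot_deriv i j (rot_deriv i j g) x - g x * rot_deriv i j (rot_deriv i j f) x"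
    if "x \<in> S4" for i j x
    unfolding q_def[abs_def]
    by (subst rot_deriv_diff) (use that f1 g1 rf rg in \<open>auto intro: C_k_on_S4_mult simp: rot_deriv_mult\<close>)
  have cont: "continuous_on S4 (\<lambda>x. f x * laplace_S4 g x)" "continuous_on S4 (\<lambda>x. g x * laplace_S4 f x)"
    using C_k_on_S4_continuous[OF f] C_k_on_S4_continuous[OF g]
    by (auto intro!: continuous_intros continuous_on_laplace_S4 f g)
  have "(\<integral>x. f x * laplace_S4 g x \<partial>S4_unif) - (\<integral>x. g x * laplace_S4 f x \<partial>S4_unif)
      = (\<integral>x. f x * laplace_S4 g x - g x * laplace_S4 f x \<partial>S4_unif)"
    by (simp add: integrable_S4_unif cont)
  also have "\<dots> = (\<integral>x. - 1/2 * (\<Sum>i\<in>UNIV. \<Sum>j\<in>UNIV. rot_deriv i j (q i j) x) \<partial>S4_unif)"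
    by (rule integral_S4_unif_cong)
      (simp add: rq laplace_S4_eq_rot_deriv f g sum_subtractf sum_distrib_left[symmetric] algebra_simps)
  also have "\<dots> = - 1/2 * (\<Sum>i\<in>UNIV. \<Sum>j\<in>UNIV. (\<integral>x. rot_deriv i j (q i j) x \<partial>S4_unif))"
    using C_k_on_S4_continuous[OF C_k_on_S4_rot_deriv[OF q1]]
    by (simp add: integrable_S4_unif Bochner_Integration.integral_sum Bochner_Integration.integrable_sum)
  also have "\<dots> = 0" by (simp add: integral_rot_deriv q1)
  finally show ?thesis by simp
qed

lemma paneitz_self_adjoint:
  assumes f: "C_k_on_S4 4 f" and g: "C_k_on_S4 4 g"
  shows "(\<integral>x. f x * (laplace_S4 (laplace_S4 g) x + 2 * laplace_S4 g x) \<partial>S4_unif)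
    = (\<integral>x. g x * (laplace_S4 (laplace_S4 f) x + 2 * laplace_S4 f x) \<partial>S4_unif)"
proof -
  have C2: "C_k_on_S4 2 f" "C_k_on_S4 2 g" "C_k_on_S4 2 (laplace_S4 f)" "C_k_on_S4 2 (laplace_S4 g)"
    using C_k_on_S4_le[OF f] C_k_on_S4_le[OF g] f g by (auto intro!: C_k_on_S4_laplace)
  have c: "continuous_on S4 u \<and> continuous_on S4 (laplace_S4 u)" if "C_k_on_S4 2 u" for u
    using that C_k_on_S4_continuous continuous_on_laplace_S4 by blast
  note cs = c[OF C2(1), THEN conjunct1] c[OF C2(1), THEN conjunct2] c[OF C2(3), THEN conjunct2]
    c[OF C2(2), THEN conjunct1] c[OF C2(2), THEN conjunct2] c[OF C2(4), THEN conjunct2]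
  have split: "(\<integral>x. u x * (laplace_S4 (laplace_S4 w) x + 2 * laplace_S4 w x) \<partial>S4_unif)
     = (\<integral>x. u x * laplace_S4 (laplace_S4 w) x \<partial>S4_unif) + 2 * (\<integral>x. u x * laplace_S4 w x \<partial>S4_unif)"
    if "continuous_on S4 u" "continuous_on S4 (laplace_S4 w)" "continuous_on S4 (laplace_S4 (laplace_S4 w))"
    for u w
  proof -
    have "(\<integral>x. u x * (laplace_S4 (laplace_S4 w) x + 2 * laplace_S4 w x) \<partial>S4_unif)
      = (\<integral>x. u x * laplace_S4 (laplace_S4 w) x + 2 * (u x * laplace_S4 w x) \<partial>S4_unif)"
      by (simp add: algebra_simps)
    also have "\<dots> = (\<integral>x. u x * laplace_S4 (laplace_S4 w) x \<partial>S4_unif) + 2 * (\<integral>x. u x * laplace_S4 w x \<partial>S4_unif)"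
      by (subst Bochner_Integration.integral_add)
        (auto intro!: integrable_S4_unif continuous_intros that)
    finally show ?thesis .
  qed
  have "(\<integral>x. laplace_S4 g x * laplace_S4 f x \<partial>S4_unif) = (\<integral>x. laplace_S4 f x * laplace_S4 g x \<partial>S4_unif)"
    by (simp only: mult.commute)
  then show ?thesis
    unfolding split[OF cs(1,5,6)] split[OF cs(4,2,3)]
    using Green_S4[OF C2(1) C2(4)] Green_S4[OF C2(2) C2(3)] Green_S4[OF C2(1,2)] by simp
qed

section \<open>Logarithmic potentials with a regularised pole\<close>

lemma DERIV_recip_power:
  fixes a t :: real
  assumes "t < a"
  shows "((\<lambda>t. (1 / (a - t)) ^ n) has_real_derivative real n * (1 / (a - t)) ^ Suc n) (at t)"
proof -
  have "((\<lambda>t. 1 / (a - t)) has_real_derivative (1 / (a - t))\<^sup>2) (at t)"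
    using assms by (auto intro!: derivative_eq_intros simp: power2_eq_square field_simps)
  from DERIV_power[OF this, of n] show ?thesis
    by (cases n) (simp_all add: power2_eq_square)
qed

lemma C_k_on_recip_power:
  "C_k_on k {y. p \<bullet> y < a} (\<lambda>y. (1 / (a - p \<bullet> y)) ^ n)"
proof (induction k arbitrary: n)
  case 0
  show ?case by (auto intro!: continuous_intros)
next
  case (Suc k)
  have "((\<lambda>y. (1 / (a - p \<bullet> y)) ^ n) has_derivative
      (\<lambda>h. (real n * (1 / (a - p \<bullet> y)) ^ Suc n) *\<^sub>R p \<bullet> h)) (at y)" if "p \<bullet> y < a" for y
    using has_derivative_compose[OF bounded_linear_imp_has_derivative[OF bounded_linear_inner_right[of p]]
        DERIV_recip_power[OF that, of n, unfolded has_field_derivative_def]]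
    by (simp only: inner_scaleR_left)
  moreover have "C_k_on k {y. p \<bullet> y < a} (\<lambda>y. (real n * (1 / (a - p \<bullet> y)) ^ Suc n) *\<^sub>R p \<bullet> e)" for e
    using C_k_on_mult[OF C_k_on_const[of k _ "real n * (p \<bullet> e)"] Suc[of "Suc n"]]
    by (simp add: mult_ac)
  ultimately show ?case
    unfolding C_k_on.simps by (intro exI[of _ "\<lambda>y. (real n * (1 / (a - p \<bullet> y)) ^ Suc n) *\<^sub>R p"]) blast
qed

lemma C_k_on_ln: "C_k_on k {y. p \<bullet> y < a} (\<lambda>y. ln (a - p \<bullet> y))"
proof (cases k)
  case 0
  then show ?thesis by (auto intro!: continuous_intros)
next
  case (Suc m)
  have "((\<lambda>y. ln (a - p \<bullet> y)) has_derivative (\<lambda>h. (- (1 / (a - p \<bullet> y))) *\<^sub>R p \<bullet> h)) (at y)"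
    if "p \<bullet> y < a" for y
  proof -
    have "((\<lambda>t. ln (a - t)) has_real_derivative - (1 / (a - p \<bullet> y))) (at (p \<bullet> y))"
      using that by (auto intro!: derivative_eq_intros)
    from has_derivative_compose[OF bounded_linear_imp_has_derivative[OF bounded_linear_inner_right[of p]]
        this[unfolded has_field_derivative_def]]
    show ?thesis by (simp only: inner_scaleR_left)
  qed
  moreover have "C_k_on m {y. p \<bullet> y < a} (\<lambda>y. (- (1 / (a - p \<bullet> y))) *\<^sub>R p \<bullet> e)" for e
    using C_k_on_mult[OF C_k_on_const[of m _ "- (p \<bullet> e)"] C_k_on_recip_power[of m p a 1]]
    by (simp add: mult_ac)
  ultimately show ?thesis
    unfolding Suc C_k_on.simps by (intro exI[of _ "\<lambda>y. (- (1 / (a - p \<bullet> y))) *\<^sub>R p"]) blast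
qed

lemma inner_S4_bounds:
  assumes "p \<in> S4" "y \<in> S4" shows "p \<bullet> y \<le> 1" "- 1 \<le> p \<bullet> y"
  using Cauchy_Schwarz_ineq2[of p y] assms by auto

context
  fixes p :: "real^5" and a :: real
  assumes p: "p \<in> S4" and a: "1 < a"
begin

lemma S4_below_pole: "open {y. p \<bullet> y < a}" "S4 \<subseteq> {y. p \<bullet> y < a}"
proof -
  show "open {y. p \<bullet> y < a}" by (rule open_halfspace_lt)
  show "S4 \<subseteq> {y. p \<bullet> y < a}"
  proof
    fix y :: "real^5" assume "y \<in> S4"
    from inner_S4_bounds(1)[OF p this] a show "y \<in> {y. p \<bullet> y < a}" by simp
  qed
qed

lemma C_k_on_S4_ln: "C_k_on_S4 k (\<lambda>y. ln (a - p \<bullet> y))"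
  by (rule C_k_on_imp_S4[OF C_k_on_ln S4_below_pole])

lemma C_k_on_S4_recip_power: "C_k_on_S4 k (\<lambda>y. (1 / (a - p \<bullet> y)) ^ n)"
  by (rule C_k_on_imp_S4[OF C_k_on_recip_power S4_below_pole])

lemma laplace_S4_ln:
  assumes x: "x \<in> S4"
  shows "laplace_S4 (\<lambda>y. ln (a - p \<bullet> y)) x
    = 3 - 2 * a * (1 / (a - p \<bullet> x)) ^ 1 - (a\<^sup>2 - 1) * (1 / (a - p \<bullet> x))\<^sup>2"
proof -
  define w where "w = 1 / (a - p \<bullet> x)"
  have "a - p \<bullet> x > 0" using inner_S4_bounds[OF p x] a by simp
  then have t: "(p \<bullet> x) * w = a * w - 1" by (simp add: w_def field_simps)
  have "laplace_S4 (\<lambda>y. ln (a - p \<bullet> y)) x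
    = 4 * (p \<bullet> x) * (- w) - (1 - (p \<bullet> x)\<^sup>2) * (- w\<^sup>2)"
    unfolding w_def
  proof (rule laplace_S4_zonal[OF p x C_k_on_S4_ln])
    fix t :: real assume "\<bar>t\<bar> \<le> 1"
    then have t: "t < a" using a by auto
    show "((\<lambda>t. ln (a - t)) has_real_derivative - (1 / (a - t))) (at t)"
      using t by (auto intro!: derivative_eq_intros)
    show "((\<lambda>t. - (1 / (a - t))) has_real_derivative - (1 / (a - t))\<^sup>2) (at t)"
      using DERIV_minus[OF DERIV_recip_power[OF t, of 1]] by (simp add: numeral_2_eq_2)
  qed
  also have "\<dots> = - 4 * ((p \<bullet> x) * w) + w\<^sup>2 - ((p \<bullet> x) * w)\<^sup>2"
    by (simp add: power2_eq_square algebra_simps)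
  also have "\<dots> = 3 - 2 * a * w ^ 1 - (a\<^sup>2 - 1) * w\<^sup>2"
    unfolding t by (simp add: power2_eq_square algebra_simps)
  finally show ?thesis unfolding w_def .
qed

text \<open>As \<open>a\<close> tends to \<open>1\<close>, the function tends to \<open>ln (norm (y - p)\<^sup>2 / 2)\<close>, which is a multiple of the
  Green function of the Paneitz operator up to a constant. The right-hand
  side says that \<open>w = - ln (a - p \<bullet> y) + ln (a\<^sup>2 - 1) / 2\<close> solves \<open>P w + 6 = 6 e\<^sup>4\<^sup>w\<close>, the equation of the round
  metrics \<open>e\<^sup>2\<^sup>w g\<close> conformal to the standard one.\<close>

lemma paneitz_ln:
  assumes x: "x \<in> S4"
  shows "laplace_S4 (laplace_S4 (\<lambda>y. ln (a - p \<bullet> y))) x + 2 * laplace_S4 (\<lambda>y. ln (a - p \<bullet> y)) x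
    = 6 - 6 * ((a\<^sup>2 - 1)\<^sup>2 * (1 / (a - p \<bullet> x)) ^ 4)"
proof -
  define w where "w = 1 / (a - p \<bullet> x)"
  have w: "w > 0" using inner_S4_bounds[OF p x] a by (simp add: w_def)
  have px: "p \<bullet> x = a - 1 / w" by (simp add: w_def)
  have reg: "C_k_on_S4 2 (\<lambda>y. 3 - 2 * a * (1 / (a - p \<bullet> y)) ^ 1 - (a\<^sup>2 - 1) * (1 / (a - p \<bullet> y))\<^sup>2)"
    by (intro C_k_on_S4_diff C_k_on_S4_const C_k_on_S4_cmult C_k_on_S4_recip_power)
  have "C_k_on_S4 2 (laplace_S4 (\<lambda>y. ln (a - p \<bullet> y)))"
    by (intro C_k_on_S4_laplace C_k_on_S4_ln)
  then have "laplace_S4 (laplace_S4 (\<lambda>y. ln (a - p \<bullet> y))) x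
      = laplace_S4 (\<lambda>y. 3 - 2 * a * (1 / (a - p \<bullet> y)) ^ 1 - (a\<^sup>2 - 1) * (1 / (a - p \<bullet> y))\<^sup>2) x"
    by (rule laplace_S4_cong[OF _ laplace_S4_ln x])
  also have "\<dots> = 4 * (p \<bullet> x) * (- 2 * a * w\<^sup>2 - 2 * (a\<^sup>2 - 1) * w ^ 3)
      - (1 - (p \<bullet> x)\<^sup>2) * (- 4 * a * w ^ 3 - 6 * (a\<^sup>2 - 1) * w ^ 4)"
    unfolding w_def
  proof (rule laplace_S4_zonal[OF p x reg])
    fix t :: real assume "\<bar>t\<bar> \<le> 1"
    then have t: "t < a" using a by auto
    note D = DERIV_recip_power[OF t]
    show "((\<lambda>t. 3 - 2 * a * (1 / (a - t)) ^ 1 - (a\<^sup>2 - 1) * (1 / (a - t))\<^sup>2) has_real_derivative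
       - 2 * a * (1 / (a - t))\<^sup>2 - 2 * (a\<^sup>2 - 1) * (1 / (a - t)) ^ 3) (at t)"
      by (rule derivative_eq_intros D refl)+ (simp add: eval_nat_numeral)
    show "((\<lambda>t. - 2 * a * (1 / (a - t))\<^sup>2 - 2 * (a\<^sup>2 - 1) * (1 / (a - t)) ^ 3) has_real_derivative
       - 4 * a * (1 / (a - t)) ^ 3 - 6 * (a\<^sup>2 - 1) * (1 / (a - t)) ^ 4) (at t)"
      by (rule derivative_eq_intros D refl)+ (simp add: eval_nat_numeral)
  qed
  finally have 1: "laplace_S4 (laplace_S4 (\<lambda>y. ln (a - p \<bullet> y))) x
     = 4 * (p \<bullet> x) * (- 2 * a * w\<^sup>2 - 2 * (a\<^sup>2 - 1) * w ^ 3)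
      - (1 - (p \<bullet> x)\<^sup>2) * (- 4 * a * w ^ 3 - 6 * (a\<^sup>2 - 1) * w ^ 4)" .
  have 2: "laplace_S4 (\<lambda>y. ln (a - p \<bullet> y)) x = 3 - 2 * a * w - (a\<^sup>2 - 1) * w\<^sup>2"
    using laplace_S4_ln[OF x] by (simp add: w_def)
  have t: "(p \<bullet> x) * w = a * w - 1" using w by (simp add: px field_simps)
  have e1: "(p \<bullet> x) * w\<^sup>2 = (a * w - 1) * w" and e2: "(p \<bullet> x) * w ^ 3 = (a * w - 1) * w\<^sup>2"
    and e3: "(p \<bullet> x)\<^sup>2 * w ^ 3 = (a * w - 1)\<^sup>2 * w"
    and e4: "(p \<bullet> x)\<^sup>2 * w ^ 4 = (a * w - 1)\<^sup>2 * w\<^sup>2"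
    unfolding t[symmetric] by (simp_all add: eval_nat_numeral)
  have "laplace_S4 (laplace_S4 (\<lambda>y. ln (a - p \<bullet> y))) x
     = - 8 * a * ((p \<bullet> x) * w\<^sup>2) - 8 * (a\<^sup>2 - 1) * ((p \<bullet> x) * w ^ 3)
       + 4 * a * w ^ 3 + 6 * (a\<^sup>2 - 1) * w ^ 4
       - 4 * a * ((p \<bullet> x)\<^sup>2 * w ^ 3) - 6 * (a\<^sup>2 - 1) * ((p \<bullet> x)\<^sup>2 * w ^ 4)"
    unfolding 1 by (simp add: algebra_simps)
  then show ?thesis
    unfolding 2 e1 e2 e3 e4 w_def[symmetric] by (simp add: eval_nat_numeral algebra_simps)
qed

end

lemma measure_S4_unif [simp]: "measure S4_unif S4 = 1"
  using prob_space.prob_space[OF prob_space_S4_unif] by simp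

text \<open>The volume density of the pull-back of the round metric under a conformal diffeomorphism of the
  sphere. As \<open>a\<close> tends to \<open>1\<close>, it concentrates at \<open>p\<close>.\<close>

definition bubble :: "real \<Rightarrow> real^5 \<Rightarrow> real^5 \<Rightarrow> real" where
  "bubble a p y = (a\<^sup>2 - 1)\<^sup>2 * (1 / (a - p \<bullet> y)) ^ 4"

lemma bubble_nonneg: "0 \<le> bubble a p y"
  by (simp add: bubble_def)

lemma continuous_on_bubble: "p \<in> S4 \<Longrightarrow> 1 < a \<Longrightarrow> continuous_on S4 (bubble a p)"
  unfolding bubble_def[abs_def]
  by (rule C_k_on_S4_continuous[OF C_k_on_S4_cmult[OF C_k_on_S4_recip_power]])

lemma continuous_on_S4_ln: "p \<in> S4 \<Longrightarrow> 1 < a \<Longrightarrow> continuous_on S4 (\<lambda>y. ln (a - p \<bullet> y))"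
  by (rule C_k_on_S4_continuous[OF C_k_on_S4_ln])

lemma laplace_S4_const: "x \<in> S4 \<Longrightarrow> laplace_S4 (\<lambda>y. c) x = 0"
  using laplace_S4_zonal[of x x "\<lambda>_. c" "\<lambda>_. 0" "\<lambda>_. 0"] by (simp add: C_k_on_S4_const)

lemma integral_paneitz:
  assumes u: "C_k_on_S4 4 u"
  shows "(\<integral>x. laplace_S4 (laplace_S4 u) x + 2 * laplace_S4 u x \<partial>S4_unif) = 0"
proof -
  have "laplace_S4 (laplace_S4 (\<lambda>y. 1)) x + 2 * laplace_S4 (\<lambda>y. 1) x = 0" if "x \<in> S4" for x
  proof -
    have "laplace_S4 (laplace_S4 (\<lambda>y. 1)) x = laplace_S4 (\<lambda>y. 0) x"
      by (rule laplace_S4_cong[OF C_k_on_S4_laplace[OF C_k_on_S4_const] laplace_S4_const that])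
    then show ?thesis using that by (simp add: laplace_S4_const)
  qed
  then have "(\<integral>x. u x * (laplace_S4 (laplace_S4 (\<lambda>y. 1)) x + 2 * laplace_S4 (\<lambda>y. 1) x) \<partial>S4_unif)
      = (\<integral>x. 0 \<partial>S4_unif)"
    by (intro integral_S4_unif_cong) simp
  then show ?thesis
    using paneitz_self_adjoint[OF C_k_on_S4_const[of 4 1] u] by simp
qed

lemma integral_bubble:
  assumes "p \<in> S4" "1 < a"
  shows "(\<integral>y. bubble a p y \<partial>S4_unif) = 1"
proof -
  have "0 = (\<integral>y. 6 - 6 * bubble a p y \<partial>S4_unif)"
    using integral_paneitz[OF C_k_on_S4_ln[OF assms]]
    by (subst (asm) integral_S4_unif_cong[where g="\<lambda>y. 6 - 6 * bubble a p y"])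
      (use assms in \<open>auto simp: paneitz_ln bubble_def\<close>)
  also have "\<dots> = 6 - 6 * (\<integral>y. bubble a p y \<partial>S4_unif)"
    using integrable_S4_unif[OF continuous_on_bubble[OF assms]] integrable_S4_unif[of "\<lambda>_. 6"]
    by (subst Bochner_Integration.integral_diff) (auto intro: integrable_S4_unif continuous_intros)
  finally show ?thesis by simp
qed

text \<open>Regularised form of Green's representation formula: in the limit \<open>a \<rightarrow> 1\<close> the left-hand side becomes
  six times the mean of \<open>u\<close> minus its value at \<open>p\<close>.\<close>

lemma representation:
  assumes "p \<in> S4" "1 < a" and u: "C_k_on_S4 4 u"
  shows "6 * (\<integral>y. u y \<partial>S4_unif) - 6 * (\<integral>y. u y * bubble a p y \<partial>S4_unif)
    = (\<integral>y. ln (a - p \<bullet> y) * (laplace_S4 (laplace_S4 u) y + 2 * laplace_S4 u y) \<partial>S4_unif)"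
proof -
  have c: "continuous_on S4 u" by (rule C_k_on_S4_continuous[OF u])
  note i = integrable_S4_unif[OF c]
    integrable_S4_unif[OF continuous_on_mult[OF c continuous_on_bubble[OF assms(1,2)]]]
  have "(\<integral>y. u y * (laplace_S4 (laplace_S4 (\<lambda>y. ln (a - p \<bullet> y))) y
        + 2 * laplace_S4 (\<lambda>y. ln (a - p \<bullet> y)) y) \<partial>S4_unif)
      = (\<integral>y. 6 * u y - 6 * (u y * bubble a p y) \<partial>S4_unif)"
    by (rule integral_S4_unif_cong) (simp add: paneitz_ln[OF assms(1,2)] bubble_def algebra_simps)
  also have "\<dots> = 6 * (\<integral>y. u y \<partial>S4_unif) - 6 * (\<integral>y. u y * bubble a p y \<partial>S4_unif)"
    using i by (subst Bochner_Integration.integral_diff) auto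
  finally show ?thesis
    using paneitz_self_adjoint[OF u C_k_on_S4_ln[OF assms(1,2)]] by simp
qed

lemma integral_zonal_eq:
  assumes p: "p \<in> S4" and q: "q \<in> S4" and c: "continuous_on S4 (\<lambda>y. F (p \<bullet> y))"
  shows "(\<integral>y. F (p \<bullet> y) \<partial>S4_unif) = (\<integral>y. (F (q \<bullet> y) :: real) \<partial>S4_unif)"
proof -
  obtain R where R: "orthogonal_transformation R" "R q = p"
    using orthogonal_transformation_exists_1[of q p] p q by auto
  have "p \<bullet> R y = q \<bullet> y" for y
    using R unfolding orthogonal_transformation_def by metis
  then show ?thesis
    using integral_S4_unif_orthogonal[OF R(1) measurable_S4_unif[OF c]] by simp
qed

text \<open>The bubbles are nonnegative, have mean \<open>1\<close> and tend to \<open>0\<close> uniformly away from \<open>p\<close>, so they form an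
  approximate identity.\<close>

lemma bubble_tendsto:
  assumes p: "p \<in> S4" and u: "continuous_on S4 u"
  shows "((\<lambda>a. \<integral>y. u y * bubble a p y \<partial>S4_unif) \<longlongrightarrow> u p) (at_right 1)"
proof (rule tendstoI)
  fix e :: real assume e: "0 < e"
  obtain B where B: "B > 0" "\<And>y. y \<in> S4 \<Longrightarrow> \<bar>u y\<bar> \<le> B" using bounded_on_S4[OF u] by blast
  obtain d where d: "d > 0" "\<And>y. y \<in> S4 \<Longrightarrow> dist y p < d \<Longrightarrow> \<bar>u y - u p\<bar> < e / 2"
    using u p e unfolding continuous_on_iff dist_real_def by (meson half_gt_zero)
  define C where "C = 2 * B * (2 / d\<^sup>2) ^ 4"
  have bound: "\<bar>(\<integral>y. u y * bubble a p y \<partial>S4_unif) - u p\<bar> \<le> e / 2 + C * (a\<^sup>2 - 1)\<^sup>2" if a: "1 < a" for a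
  proof -
    have cb: "continuous_on S4 (bubble a p)" by (rule continuous_on_bubble[OF p a])
    have pt: "\<bar>(u y - u p) * bubble a p y\<bar> \<le> e / 2 * bubble a p y + C * (a\<^sup>2 - 1)\<^sup>2" if y: "y \<in> S4" for y
    proof (cases "dist y p < d")
      case True
      have "\<bar>u y - u p\<bar> * bubble a p y \<le> e / 2 * bubble a p y"
        using d(2)[OF y True] bubble_nonneg by (intro mult_right_mono) auto
      moreover have "0 \<le> C * (a\<^sup>2 - 1)\<^sup>2" using B by (simp add: C_def)
      ultimately show ?thesis using bubble_nonneg[of a p y] by (simp add: abs_mult)
    next
      case False
      have "(dist y p)\<^sup>2 = 2 - 2 * (p \<bullet> y)"
        using y p by (simp add: dist_norm power2_norm_eq_inner inner_diff_left inner_diff_right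
            norm_eq_1 inner_commute)
      moreover have "d\<^sup>2 \<le> (dist y p)\<^sup>2" using False d(1) by (intro power_mono) auto
      ultimately have *: "d\<^sup>2 / 2 \<le> a - p \<bullet> y" using a by simp
      have "1 / (a - p \<bullet> y) \<le> 2 / d\<^sup>2"
        using d(1) divide_left_mono[OF *, of 1] order.strict_trans2[OF _ *, of 0] by simp
      moreover have "0 \<le> 1 / (a - p \<bullet> y)" using * d(1) order_trans[OF _ *, of 0] by simp
      ultimately have "(1 / (a - p \<bullet> y)) ^ 4 \<le> (2 / d\<^sup>2) ^ 4"
        by (intro power_mono)
      then have "bubble a p y \<le> (a\<^sup>2 - 1)\<^sup>2 * (2 / d\<^sup>2) ^ 4"
        unfolding bubble_def by (intro mult_left_mono) auto
      moreover have "\<bar>u y - u p\<bar> \<le> 2 * B" using B(2)[OF y] B(2)[OF p] by linarith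
      ultimately have "\<bar>u y - u p\<bar> * bubble a p y \<le> (2 * B) * ((a\<^sup>2 - 1)\<^sup>2 * (2 / d\<^sup>2) ^ 4)"
        using bubble_nonneg B(1) by (intro mult_mono) auto
      moreover have "0 \<le> e / 2 * bubble a p y" using e bubble_nonneg by simp
      ultimately show ?thesis using bubble_nonneg[of a p y] by (simp add: abs_mult C_def mult_ac)
    qed
    have "(\<integral>y. u y * bubble a p y \<partial>S4_unif) - u p
        = (\<integral>y. u y * bubble a p y \<partial>S4_unif) - (\<integral>y. u p * bubble a p y \<partial>S4_unif)"
      using integral_bubble[OF p a] by simp
    also have "\<dots> = (\<integral>y. (u y - u p) * bubble a p y \<partial>S4_unif)"
      by (subst Bochner_Integration.integral_diff[symmetric])
        (auto intro!: integrable_S4_unif continuous_intros u cb simp: left_diff_distrib)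
    finally have "\<bar>(\<integral>y. u y * bubble a p y \<partial>S4_unif) - u p\<bar> \<le> (\<integral>y. \<bar>(u y - u p) * bubble a p y\<bar> \<partial>S4_unif)"
      using integral_abs_bound[of S4_unif "\<lambda>y. (u y - u p) * bubble a p y"] by simp
    also have "\<dots> \<le> (\<integral>y. e / 2 * bubble a p y + C * (a\<^sup>2 - 1)\<^sup>2 \<partial>S4_unif)"
      using pt by (intro integral_mono) (auto intro!: integrable_S4_unif continuous_intros u cb)
    also have "\<dots> = e / 2 + C * (a\<^sup>2 - 1)\<^sup>2"
      by (subst Bochner_Integration.integral_add)
        (auto intro!: integrable_S4_unif continuous_intros cb simp: integral_bubble[OF p a])
    finally show ?thesis .
  qed
  have "((\<lambda>a. C * (a\<^sup>2 - 1)\<^sup>2) \<longlongrightarrow> C * (1\<^sup>2 - 1)\<^sup>2) (at_right 1)"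
    by (intro tendsto_intros)
  then have "\<forall>\<^sub>F a in at_right 1. C * (a\<^sup>2 - 1)\<^sup>2 < e / 2"
    using e by (intro order_tendstoD) auto
  then show "\<forall>\<^sub>F a in at_right 1. dist (\<integral>y. u y * bubble a p y \<partial>S4_unif) (u p) < e"
    using eventually_at_right_less[of "1::real"]
  proof eventually_elim
    case (elim a)
    then show ?case using bound[of a] by (simp add: dist_real_def)
  qed
qed

text \<open>A cap \<open>{y. 1 - p \<bullet> y < r}\<close> has measure of order \<open>r\<^sup>2\<close>: on it the bubble with parameter \<open>1 + r\<close> is at
  least \<open>1 / (4 * r\<^sup>2)\<close> and has mean \<open>1\<close>. Passing from \<open>r\<close> to \<open>r / 2\<close> lowers the logarithmic excess by at most
  \<open>ln 2\<close> on this cap, so the excesses are dominated by a geometric series. The induction ends at a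
  scale below \<open>a - 1\<close>, where the excess vanishes; the bound is uniform in \<open>a\<close>.\<close>

lemma integral_log_excess:
  assumes p: "p \<in> S4" and a: "1 < a" and "0 < r" "r \<le> 2 ^ n * (a - 1)"
  shows "(\<integral>y. max 0 (ln r - ln (a - p \<bullet> y)) \<partial>S4_unif) \<le> 6 * r\<^sup>2"
  using assms(3,4)
proof (induction n arbitrary: r)
  case 0
  have "max 0 (ln r - ln (a - p \<bullet> y)) = 0" if "y \<in> S4" for y
    using inner_S4_bounds[OF p that] 0 a by auto
  then have "(\<integral>y. max 0 (ln r - ln (a - p \<bullet> y)) \<partial>S4_unif) = (\<integral>y. 0 \<partial>S4_unif)"
    by (rule integral_S4_unif_cong)
  then show ?case by simp
next
  case (Suc n)
  have r: "0 < r" "1 < 1 + r" using Suc.prems by auto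
  have c: "continuous_on S4 (\<lambda>y. max 0 (ln r' - ln (a - p \<bullet> y)))" for r'
    by (intro continuous_intros continuous_on_S4_ln p a continuous_on_max)
  have cb: "continuous_on S4 (bubble (1 + r) p)" by (rule continuous_on_bubble[OF p r(2)])
  \<comment> \<open>off the cap the left-hand side vanishes, on it the bubble term pays for the \<open>ln 2\<close>\<close>
  have pt: "max 0 (ln r - ln (a - p \<bullet> y))
      \<le> max 0 (ln (r / 2) - ln (a - p \<bullet> y)) + 4 * r\<^sup>2 * bubble (1 + r) p y" if y: "y \<in> S4" for y
  proof (cases "a - p \<bullet> y \<le> r")
    case False
    then have "ln r \<le> ln (a - p \<bullet> y)" using r(1) by simp
    then have "max 0 (ln r - ln (a - p \<bullet> y)) = 0" by simp
    moreover have "0 \<le> 4 * r\<^sup>2 * bubble (1 + r) p y" by (simp add: bubble_nonneg)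
    ultimately show ?thesis by linarith
  next
    case True
    define z where "z = 1 + r - p \<bullet> y"
    have z: "0 < z" "z \<le> 2 * r" using True a r inner_S4_bounds[OF p y] by (auto simp: z_def)
    \<comment> \<open>the bubble of parameter \<open>1 + r\<close> dominates \<open>1 / (4 * r\<^sup>2)\<close> on the cap\<close>
    have "1 / (2 * r) \<le> 1 / z" using z by (intro divide_left_mono) auto
    then have "(1 / (2 * r)) ^ 4 \<le> (1 / z) ^ 4" using r by (intro power_mono) auto
    moreover have "(2 * r)\<^sup>2 \<le> ((1 + r)\<^sup>2 - 1)\<^sup>2"
      using r by (intro power_mono) (auto simp: power2_eq_square algebra_simps)
    ultimately have "(2 * r)\<^sup>2 * (1 / (2 * r)) ^ 4 \<le> bubble (1 + r) p y"
      unfolding bubble_def z_def by (intro mult_mono) auto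
    then have "4 * r\<^sup>2 * ((2 * r)\<^sup>2 * (1 / (2 * r)) ^ 4) \<le> 4 * r\<^sup>2 * bubble (1 + r) p y"
      by (intro mult_left_mono) auto
    moreover have "4 * r\<^sup>2 * ((2 * r)\<^sup>2 * (1 / (2 * r)) ^ 4) = 1"
      using r by (simp add: field_simps)
    moreover have "ln (r / 2) = ln r - ln 2" using r by (simp add: ln_div)
    moreover have "ln 2 \<le> (1::real)" using ln_le_minus_one[of "2::real"] by simp
    ultimately show ?thesis by (auto simp: max_def)
  qed
  have "(\<integral>y. max 0 (ln r - ln (a - p \<bullet> y)) \<partial>S4_unif)
      \<le> (\<integral>y. max 0 (ln (r / 2) - ln (a - p \<bullet> y)) + 4 * r\<^sup>2 * bubble (1 + r) p y \<partial>S4_unif)"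
    using pt by (intro integral_mono) (auto intro!: integrable_S4_unif continuous_intros c cb)
  also have "\<dots> = (\<integral>y. max 0 (ln (r / 2) - ln (a - p \<bullet> y)) \<partial>S4_unif) + 4 * r\<^sup>2"
    by (subst Bochner_Integration.integral_add)
      (auto intro!: integrable_S4_unif continuous_intros c cb simp: integral_bubble[OF p r(2)])
  also have "\<dots> \<le> 6 * (r / 2)\<^sup>2 + 4 * r\<^sup>2"
    using Suc.IH[of "r / 2"] Suc.prems by simp
  also have "\<dots> \<le> 6 * r\<^sup>2" by (simp add: power_divide)
  finally show ?case .
qed

section \<open>The estimate\<close>

text \<open>In the comparison of \<open>u p\<close> with \<open>u q\<close>, the pole at \<open>q\<close> contributes at most \<open>ln 3\<close> because
  \<open>a - q \<bullet> y \<le> 3\<close>. The pole at \<open>p\<close> is worst when the mass of the right-hand side \<open>f\<close> concentrates near \<open>p\<close>; the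
  bound \<open>f \<le> b * exp (4 * u p)\<close> prevents this below the scale \<open>r = exp (- 2 * u p)\<close>, measured in
  \<open>1 - p \<bullet> y\<close>. The contribution from outside this scale is \<open>- ln r = 2 * u p\<close>, that from inside is bounded.\<close>

lemma sup_inf_estimate:
  assumes b: "b > 0" and V: "\<And>x. x \<in> S4 \<Longrightarrow> 0 \<le> V x \<and> V x \<le> b" and sol: "paneitz_solution V u"
    and p: "p \<in> S4" "\<And>x. x \<in> S4 \<Longrightarrow> u x \<le> u p" and q: "q \<in> S4"
  shows "u p + u q \<ge> - (ln 3 + b)"
proof -
  define f where "f x = laplace_S4 (laplace_S4 u) x + 2 * laplace_S4 u x + 6" for x
  define B where "B = b * exp (4 * u p)"
  define r where "r = exp (- 2 * u p)"
  have u: "C_k_on_S4 4 u" and feq: "\<And>x. x \<in> S4 \<Longrightarrow> f x = V x * exp (4 * u x)"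
    using sol by (auto simp: paneitz_solution_def f_def)
  have f0: "0 \<le> f x" if "x \<in> S4" for x
    using V[OF that] by (simp add: feq[OF that])
  have fB: "f x \<le> B" if "x \<in> S4" for x
    unfolding feq[OF that] B_def using V[OF that] p(2)[OF that] b by (intro mult_mono) auto
  have cu: "continuous_on S4 u" by (rule C_k_on_S4_continuous[OF u])
  have C2: "C_k_on_S4 2 u" "C_k_on_S4 2 (laplace_S4 u)"
    using C_k_on_S4_le[OF u] u by (auto intro!: C_k_on_S4_laplace)
  have cf: "continuous_on S4 f"
    unfolding f_def[abs_def] by (intro continuous_intros continuous_on_laplace_S4 C2)
  have mass: "(\<integral>y. f y \<partial>S4_unif) = 6"
    unfolding f_def
    by (subst Bochner_Integration.integral_add)
      (auto intro!: integrable_S4_unif continuous_intros continuous_on_laplace_S4 C2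
        simp: integral_paneitz[OF u])
  have rep: "6 * (\<integral>y. u y \<partial>S4_unif) - 6 * (\<integral>y. u y * bubble a z y \<partial>S4_unif)
      = (\<integral>y. ln (a - z \<bullet> y) * f y \<partial>S4_unif) - 6 * (\<integral>y. ln (a - z \<bullet> y) \<partial>S4_unif)"
    if z: "z \<in> S4" and a: "1 < a" for a z
  proof -
    have "(\<integral>y. ln (a - z \<bullet> y) * (laplace_S4 (laplace_S4 u) y + 2 * laplace_S4 u y) \<partial>S4_unif)
      = (\<integral>y. ln (a - z \<bullet> y) * f y - 6 * ln (a - z \<bullet> y) \<partial>S4_unif)"
      by (simp add: f_def algebra_simps)
    also have "\<dots> = (\<integral>y. ln (a - z \<bullet> y) * f y \<partial>S4_unif) - 6 * (\<integral>y. ln (a - z \<bullet> y) \<partial>S4_unif)"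
      by (subst Bochner_Integration.integral_diff)
        (auto intro!: integrable_S4_unif continuous_on_mult continuous_on_const cf continuous_on_S4_ln z a)
    finally show ?thesis using representation[OF z a u] by simp
  qed
  have key: "(\<integral>y. u y * bubble a p y \<partial>S4_unif) - (\<integral>y. u y * bubble a q y \<partial>S4_unif) \<le> ln 3 + 2 * u p + b"
    if a: "1 < a" "a < 2" for a
  proof -
    note cl = continuous_on_S4_ln[OF p(1) a(1)] continuous_on_S4_ln[OF q a(1)]
    have "6 * ((\<integral>y. u y * bubble a p y \<partial>S4_unif) - (\<integral>y. u y * bubble a q y \<partial>S4_unif))
       = (\<integral>y. ln (a - q \<bullet> y) * f y \<partial>S4_unif) + (\<integral>y. - ln (a - p \<bullet> y) * f y \<partial>S4_unif)"
      \<comment> \<open>the means of the two logarithms cancel by rotation invariance\<close>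
      using rep[OF p(1) a(1)] rep[OF q a(1)]
        integral_zonal_eq[OF p(1) q, of "\<lambda>t. ln (a - t)"] cl by simp
    also have "(\<integral>y. ln (a - q \<bullet> y) * f y \<partial>S4_unif) \<le> (\<integral>y. ln 3 * f y \<partial>S4_unif)"
    proof (rule integral_mono)
      fix y assume "y \<in> space S4_unif"
      then have y: "y \<in> S4" by simp
      have "ln (a - q \<bullet> y) \<le> ln 3"
        using inner_S4_bounds[OF q y] a by simp
      then show "ln (a - q \<bullet> y) * f y \<le> ln 3 * f y" using f0[OF y] by (intro mult_right_mono)
    qed (intro integrable_S4_unif continuous_on_mult continuous_on_const cf cl)+
    also have "(\<integral>y. ln 3 * f y \<partial>S4_unif) = 6 * ln 3" using mass by simp
    also have "(\<integral>y. - ln (a - p \<bullet> y) * f y \<partial>S4_unif)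
        \<le> (\<integral>y. 2 * u p * f y + B * max 0 (ln r - ln (a - p \<bullet> y)) \<partial>S4_unif)"
    proof (rule integral_mono)
      fix y assume "y \<in> space S4_unif"
      then have y: "y \<in> S4" by simp
      let ?m = "max 0 (ln r - ln (a - p \<bullet> y))"
      have "- ln (a - p \<bullet> y) \<le> 2 * u p + ?m" by (simp add: r_def)
      then have "- ln (a - p \<bullet> y) * f y \<le> (2 * u p + ?m) * f y"
        using f0[OF y] by (rule mult_right_mono)
      also have "\<dots> \<le> 2 * u p * f y + B * ?m"
        using mult_right_mono[OF fB[OF y], of ?m] by (simp add: algebra_simps)
      finally show "- ln (a - p \<bullet> y) * f y \<le> 2 * u p * f y + B * ?m" .
    qed (intro integrable_S4_unif continuous_on_mult continuous_on_add continuous_on_max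
        continuous_on_diff continuous_on_minus continuous_on_const cf cl)+
    also have "\<dots> = 12 * u p + B * (\<integral>y. max 0 (ln r - ln (a - p \<bullet> y)) \<partial>S4_unif)"
      by (subst Bochner_Integration.integral_add)
        (auto intro!: integrable_S4_unif continuous_on_mult continuous_on_max continuous_on_diff
          continuous_on_const cf cl simp: mass)
    also have "\<dots> \<le> 12 * u p + B * (6 * r\<^sup>2)"
    proof -
      obtain n where "r / (a - 1) < 2 ^ n" using real_arch_pow[of 2 "r / (a - 1)"] by auto
      then have "r \<le> 2 ^ n * (a - 1)" using a by (simp add: field_simps)
      then have "(\<integral>y. max 0 (ln r - ln (a - p \<bullet> y)) \<partial>S4_unif) \<le> 6 * r\<^sup>2"
        by (intro integral_log_excess[OF p(1) a(1)]) (auto simp: r_def)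
      then show ?thesis using b by (intro add_left_mono mult_left_mono) (auto simp: B_def)
    qed
    also have "B * (6 * r\<^sup>2) = 6 * b"
      by (simp add: B_def r_def power2_eq_square mult_ac flip: exp_add)
    finally show ?thesis by simp
  qed
  have "((\<lambda>a. (\<integral>y. u y * bubble a p y \<partial>S4_unif) - (\<integral>y. u y * bubble a q y \<partial>S4_unif)) \<longlongrightarrow> u p - u q) (at_right 1)"
    by (intro tendsto_diff bubble_tendsto p q cu)
  moreover have "\<forall>\<^sub>F a in at_right (1::real). a \<in> {1<..<2}"
    using eventually_at_right_real[of 1 2] by simp
  then have "\<forall>\<^sub>F a in at_right 1.
      (\<integral>y. u y * bubble a p y \<partial>S4_unif) - (\<integral>y. u y * bubble a q y \<partial>S4_unif) \<le> ln 3 + 2 * u p + b"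
    by eventually_elim (use key in auto)
  ultimately have "u p - u q \<le> ln 3 + 2 * u p + b"
    by (rule tendsto_upperbound) simp
  then show ?thesis by simp
qed

theorem mainTheorem1:
  fixes b :: real
  assumes "b > 0"
  shows "\<exists>c::real. \<forall>V u :: real^5 \<Rightarrow> real.
           (\<forall>x\<in>S4. 0 \<le> V x \<and> V x \<le> b) \<longrightarrow> paneitz_solution V u \<longrightarrow>
           (SUP x\<in>S4. u x) + (INF x\<in>S4. u x) \<ge> c"
proof (intro exI[of _ "- (ln 3 + b)"] allI impI)
  fix V u :: "real^5 \<Rightarrow> real"
  assume V: "\<forall>x\<in>S4. 0 \<le> V x \<and> V x \<le> b" and sol: "paneitz_solution V u"
  have cu: "continuous_on S4 u"
    using sol C_k_on_S4_continuous unfolding paneitz_solution_def by blast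
  have ne: "S4 \<noteq> {}" by simp
  obtain p where p: "p \<in> S4" "\<forall>x\<in>S4. u x \<le> u p"
    using continuous_attains_sup[OF compact_sphere ne cu] by blast
  obtain q where q: "q \<in> S4" "\<forall>x\<in>S4. u q \<le> u x"
    using continuous_attains_inf[OF compact_sphere ne cu] by blast
  have "(SUP x\<in>S4. u x) = u p" using p by (intro cSup_eq_maximum) auto
  moreover have "(INF x\<in>S4. u x) = u q" using q by (intro cInf_eq_minimum) auto
  ultimately show "- (ln 3 + b) \<le> (SUP x\<in>S4. u x) + (INF x\<in>S4. u x)"
    using sup_inf_estimate[OF assms _ sol p(1) _ q(1)] V p(2) by auto
qed

end
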